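(* Let $G$ be a topological group and let $p\colon E\to B$ be a $G$-fibration. Let $E_{B,G}=(E\times_B E)/G$ be the orbit space for the diagonal action, and let $d_GE\subseteq E_{B,G}$ denote the image of the diagonal $\Delta(E)\subseteq E\times_B E$ under the orbit map $E\times_B E\to E_{B,G}$. If there exist cohomology classes $u_1,\dots,u_k\in H^*(E_{B,G};R)$ (for any commutative ring $R$) such that 1. $u_i$ restricts to zero in $H^*(d_GE;R)$ for $i=1,\dots,k$; 2. $u_1\smile\cdots\smile u_k\ne 0$ in $H^*(E_{B,G};R)$, then $\mathrm{TC}_G[p\colon E\to B]>k$.
   Context: All $G$-spaces are Hausdorff, $I=[0,1]$, path spaces carry the compact-open topology. A $G$-map is a continuous equivariant map; a $G$-homotopy is an equivariant homotopy ($G$ acting trivially on $I$). A $G$-fibration is a $G$-map with the $G$-homotopy lifting property with respect to every $G$-space. Equivariant sectional category: for a $G$-map $q\colon X\to Y$, $\mathrm{secat}_G(q)$ is the least positive integer $k$ such that $Y$ has a cover by $G$-invariant open sets $U_1,\dots,U_k$ with $G$-maps $s_i\colon U_i\to X$ such that $q\circ s_i$ is $G$-homotopic to the inclusion $U_i\hookrightarrow Y$ ($\infty$ if there is no such $k$). Equivariant parametrized topological complexity: for a $G$-fibration $p\colon E\to B$, let $E^I_B$ be the space of paths $\gamma\colon I\to E$ whose image lies in a single fibre of $p$, with $(g\cdot\gamma)(t)=g\cdot\gamma(t)$, and $E\times_B E=\{(e_1,e_2)\in E\times E: p(e_1)=p(e_2)\}$ with the diagonal action. The map $\Pi\colon E^I_B\to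 E\times_B E$, $\Pi(\gamma)=(\gamma(0),\gamma(1))$, is a $G$-fibration, and $\mathrm{TC}_G[p\colon E\to B]:=\mathrm{secat}_G(\Pi)$. Also $\Delta(E)=\{(e,e):e\in E\}$. *)

theory Defs
  imports "HOL-Analysis.Analysis" "HOL-Homology.Homology" "HOL-Library.Extended_Nat"
begin

section \<open>Spaces with a group action\<close>

text \<open>
  Topological groups are the types of class \<^class>\<open>topological_group_add\<close>: the group law is written
  additively, but the class does not require it to be commutative.  \<open>G\<close>-spaces are Hausdorff.
\<close>

definition G_space :: "('g::topological_group_add \<Rightarrow> 'a \<Rightarrow> 'a) \<Rightarrow> 'a topology \<Rightarrow> bool" where
  "G_space \<alpha> X \<longleftrightarrow>
     Hausdorff_space X \<and>
     continuous_map (prod_topology euclidean X) X (\<lambda>(g, x). \<alpha> g x) \<and>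
     (\<forall>x\<in>topspace X. \<alpha> 0 x = x) \<and>
     (\<forall>g h. \<forall>x\<in>topspace X. \<alpha> (g + h) x = \<alpha> g (\<alpha> h x))"

definition equivariant_on :: "'a set \<Rightarrow> ('g \<Rightarrow> 'a \<Rightarrow> 'a) \<Rightarrow> ('g \<Rightarrow> 'b \<Rightarrow> 'b) \<Rightarrow> ('a \<Rightarrow> 'b) \<Rightarrow> bool" where
  "equivariant_on S \<alpha> \<beta> f \<longleftrightarrow> (\<forall>g. \<forall>x\<in>S. f (\<alpha> g x) = \<beta> g (f x))"

definition G_map ::
  "('g \<Rightarrow> 'a \<Rightarrow> 'a) \<Rightarrow> 'a topology \<Rightarrow> ('g \<Rightarrow> 'b \<Rightarrow> 'b) \<Rightarrow> 'b topology \<Rightarrow> ('a \<Rightarrow> 'b) \<Rightarrow> bool" where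
  "G_map \<alpha> X \<beta> Y f \<longleftrightarrow> continuous_map X Y f \<and> equivariant_on (topspace X) \<alpha> \<beta> f"

definition G_invariant :: "('g \<Rightarrow> 'a \<Rightarrow> 'a) \<Rightarrow> 'a set \<Rightarrow> bool" where
  "G_invariant \<alpha> U \<longleftrightarrow> (\<forall>g. \<forall>x\<in>U. \<alpha> g x \<in> U)"

text \<open>
  Since \<open>G\<close> acts trivially on the interval, a \<open>G\<close>-homotopy is a homotopy through equivariant maps.
\<close>

definition G_homotopic ::
  "('g \<Rightarrow> 'a \<Rightarrow> 'a) \<Rightarrow> 'a topology \<Rightarrow> ('g \<Rightarrow> 'b \<Rightarrow> 'b) \<Rightarrow> 'b topology \<Rightarrow> ('a \<Rightarrow> 'b) \<Rightarrow> ('a \<Rightarrow> 'b) \<Rightarrow> bool" where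
  "G_homotopic \<alpha> X \<beta> Y = homotopic_with (equivariant_on (topspace X) \<alpha> \<beta>) X Y"

definition prod_act :: "('g \<Rightarrow> 'a \<Rightarrow> 'a) \<Rightarrow> ('g \<Rightarrow> 'b \<Rightarrow> 'b) \<Rightarrow> 'g \<Rightarrow> 'a \<times> 'b \<Rightarrow> 'a \<times> 'b" where
  "prod_act \<alpha> \<beta> g = (\<lambda>(x, y). (\<alpha> g x, \<beta> g y))"

abbreviation unit_interval :: "real topology" where
  "unit_interval \<equiv> top_of_set {0..1}"

abbreviation cylinder :: "'a topology \<Rightarrow> (real \<times> 'a) topology" where
  "cylinder X \<equiv> prod_topology unit_interval X"

abbreviation cylinder_act :: "('g \<Rightarrow> 'a \<Rightarrow> 'a) \<Rightarrow> 'g \<Rightarrow> real \<times> 'a \<Rightarrow> real \<times> 'a" where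
  "cylinder_act \<alpha> \<equiv> prod_act (\<lambda>g t. t) \<alpha>"

section \<open>Path spaces\<close>

text \<open>
  The compact-open topology on the space of paths.  Paths are extensional, so that distinct
  elements differ at some point of the interval.
\<close>

definition paths :: "'a topology \<Rightarrow> (real \<Rightarrow> 'a) set" where
  "paths X = {\<gamma> \<in> extensional {0..1}. pathin X \<gamma>}"

definition path_topology :: "'a topology \<Rightarrow> (real \<Rightarrow> 'a) topology" where
  "path_topology X =
     topology_generated_by {{\<gamma> \<in> paths X. \<gamma> ` K \<subseteq> U} |K U. compact K \<and> K \<subseteq> {0..1} \<and> openin X U}"

definition path_act :: "('g \<Rightarrow> 'a \<Rightarrow> 'a) \<Rightarrow> 'g \<Rightarrow> (real \<Rightarrow> 'a) \<Rightarrow> real \<Rightarrow> 'a" where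
  "path_act \<alpha> g \<gamma> = (\<lambda>t\<in>{0..1}. \<alpha> g (\<gamma> t))"

section \<open>Equivariant fibrations\<close>

definition G_homotopy_lifting ::
  "'z itself \<Rightarrow> ('g::topological_group_add \<Rightarrow> 'e \<Rightarrow> 'e) \<Rightarrow> 'e topology \<Rightarrow>
   ('g \<Rightarrow> 'b \<Rightarrow> 'b) \<Rightarrow> 'b topology \<Rightarrow> ('e \<Rightarrow> 'b) \<Rightarrow> bool" where
  "G_homotopy_lifting _ \<alpha> E \<beta> B p \<longleftrightarrow>
     (\<forall>(Z :: 'z topology) \<zeta> f H.
        G_space \<zeta> Z \<longrightarrow> G_map \<zeta> Z \<alpha> E f \<longrightarrow> G_map (cylinder_act \<zeta>) (cylinder Z) \<beta> B H \<longrightarrow>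
        (\<forall>z\<in>topspace Z. H (0, z) = p (f z)) \<longrightarrow>
        (\<exists>K. G_map (cylinder_act \<zeta>) (cylinder Z) \<alpha> E K \<and>
             (\<forall>z\<in>topspace Z. K (0, z) = f z) \<and>
             (\<forall>w\<in>topspace (cylinder Z). p (K w) = H w)))"

text \<open>
  A definition cannot quantify over the types carrying the test spaces.  It suffices to fix the type
  of pairs of a point of \<open>E\<close> and a path in \<open>B\<close>, because the mapping path space of \<open>p\<close> is a universal
  test space: see \<open>G_fibration_imp_G_homotopy_lifting\<close> below, which gives lifting for all \<open>G\<close>-spaces
  over arbitrary types.
\<close>

definition G_fibration ::
  "('g::topological_group_add \<Rightarrow> 'e \<Rightarrow> 'e) \<Rightarrow> 'e topology \<Rightarrow>
   ('g \<Rightarrow> 'b \<Rightarrow> 'b) \<Rightarrow> 'b topology \<Rightarrow> ('e \<Rightarrow> 'b) \<Rightarrow> bool" where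
  "G_fibration \<alpha> E \<beta> B p \<longleftrightarrow>
     G_map \<alpha> E \<beta> B p \<and> G_homotopy_lifting TYPE('e \<times> (real \<Rightarrow> 'b)) \<alpha> E \<beta> B p"

lemma topspace_path_topology [simp]: "topspace (path_topology X) = paths X"
proof -
  have "paths X = {\<gamma> \<in> paths X. \<gamma> ` {} \<subseteq> {}}" by simp
  then have "paths X \<in> {{\<gamma> \<in> paths X. \<gamma> ` K \<subseteq> U} |K U. compact K \<and> K \<subseteq> {0..1} \<and> openin X U}"
    by blast
  then show ?thesis
    unfolding path_topology_def topology_generated_by_topspace by blast
qed

lemma openin_path_topology:
  assumes "compact K" "K \<subseteq> {0..1}" "openin X U"
  shows "openin (path_topology X) {\<gamma> \<in> paths X. \<gamma> ` K \<subseteq> U}"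
  unfolding path_topology_def by (rule topology_generated_by_Basis) (use assms in blast)

lemma Hausdorff_path_topology:
  assumes "Hausdorff_space X"
  shows "Hausdorff_space (path_topology X)"
  unfolding Hausdorff_space_def
proof (intro allI impI, elim conjE)
  fix \<gamma> \<delta> assume g: "\<gamma> \<in> topspace (path_topology X)" "\<delta> \<in> topspace (path_topology X)" "\<gamma> \<noteq> \<delta>"
  then obtain t where t: "t \<in> {0..1}" "\<gamma> t \<noteq> \<delta> t"
    using extensionalityI[of \<gamma> "{0..1}" \<delta>] unfolding topspace_path_topology paths_def by blast
  moreover have "\<gamma> t \<in> topspace X" "\<delta> t \<in> topspace X"
    using g t by (auto simp: paths_def pathin_def continuous_map_def Pi_iff)
  ultimately obtain U V where UV: "openin X U" "openin X V" "\<gamma> t \<in> U" "\<delta> t \<in> V" "disjnt U V"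
    using assms unfolding Hausdorff_space_def by metis
  let ?N = "\<lambda>U. {\<gamma> \<in> paths X. \<gamma> ` {t} \<subseteq> U}"
  have "openin (path_topology X) (?N U)" "openin (path_topology X) (?N V)"
    by (rule openin_path_topology; use UV t in simp)+
  moreover have "\<gamma> \<in> ?N U" "\<delta> \<in> ?N V" using g UV by auto
  moreover have "disjnt (?N U) (?N V)" using UV by (auto simp: disjnt_iff)
  ultimately show "\<exists>U V. openin (path_topology X) U \<and> openin (path_topology X) V \<and>
                     \<gamma> \<in> U \<and> \<delta> \<in> V \<and> disjnt U V"
    by blast
qed

lemma continuous_map_into_path_topology:
  assumes H: "continuous_map (cylinder Z) X H"
  shows "continuous_map Z (path_topology X) (\<lambda>z. \<lambda>t\<in>{0..1}. H (t, z))"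
proof -
  let ?h = "\<lambda>z. \<lambda>t\<in>{0..1}. H (t, z)"
  have P: "?h z \<in> paths X" if "z \<in> topspace Z" for z
  proof -
    have "continuous_map unit_interval X (\<lambda>t. H (t, z))"
      by (rule continuous_map_compose[OF _ H, unfolded o_def])
         (use that in \<open>auto intro!: continuous_map_pairedI\<close>)
    then have "continuous_map unit_interval X (?h z)"
      by (rule continuous_map_eq) auto
    then show ?thesis by (auto simp: paths_def pathin_def)
  qed
  have O: "openin Z (?h -` {\<gamma> \<in> paths X. \<gamma> ` K \<subseteq> U} \<inter> topspace Z)"
    if K: "compact K" "K \<subseteq> {0..1}" and U: "openin X U" for K U
  proof (subst openin_subopen, intro ballI)
    fix z assume z: "z \<in> ?h -` {\<gamma> \<in> paths X. \<gamma> ` K \<subseteq> U} \<inter> topspace Z"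
    let ?W = "{w \<in> topspace (cylinder Z). H w \<in> U}"
    have W: "openin (cylinder Z) ?W"
      using H U by (rule openin_continuous_map_preimage)
    have cK: "compactin unit_interval K" using K by (simp add: compactin_subtopology)
    have "K \<times> {z} \<subseteq> ?W" using z K by (auto simp: image_subset_iff subset_iff)
    then obtain A V where "openin unit_interval A" "openin Z V" "K \<subseteq> A" "{z} \<subseteq> V" "A \<times> V \<subseteq> ?W"
      using Wallace_theorem_prod_topology[OF cK _ W, of "{z}"] z by auto
    moreover have "V \<subseteq> ?h -` {\<gamma> \<in> paths X. \<gamma> ` K \<subseteq> U} \<inter> topspace Z"
    proof
      fix v assume v: "v \<in> V"
      then have vZ: "v \<in> topspace Z" using \<open>openin Z V\<close> openin_subset by blast
      have "?h v ` K \<subseteq> U"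
        using v \<open>K \<subseteq> A\<close> \<open>A \<times> V \<subseteq> ?W\<close> K(2) by (auto simp: subset_iff)
      then show "v \<in> ?h -` {\<gamma> \<in> paths X. \<gamma> ` K \<subseteq> U} \<inter> topspace Z"
        using P[OF vZ] vZ by simp
    qed
    ultimately show "\<exists>T. openin Z T \<and> z \<in> T \<and> T \<subseteq> ?h -` {\<gamma> \<in> paths X. \<gamma> ` K \<subseteq> U} \<inter> topspace Z"
      by blast
  qed
  have "?h ` topspace Z \<subseteq> topspace (path_topology X)"
    using P by auto
  then show ?thesis
    unfolding path_topology_def
    by (intro continuous_on_generated_topo) (use O in \<open>auto simp: path_topology_def\<close>)
qed

lemma continuous_map_path_eval: "continuous_map (cylinder (path_topology X)) X (\<lambda>(t, \<gamma>). \<gamma> t)"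
  unfolding continuous_map_def
proof (intro conjI allI impI)
  show "(\<lambda>(t, \<gamma>). \<gamma> t) \<in> topspace (cylinder (path_topology X)) \<rightarrow> topspace X"
    by (auto simp: paths_def pathin_def continuous_map_def Pi_iff)
  fix U assume U: "openin X U"
  let ?W = "{w \<in> topspace (cylinder (path_topology X)). (case w of (t, \<gamma>) \<Rightarrow> \<gamma> t) \<in> U}"
  show "openin (cylinder (path_topology X)) ?W"
  proof (subst openin_subopen, intro ballI)
    fix w assume "w \<in> ?W"
    then obtain t \<gamma> where w: "w = (t, \<gamma>)" "t \<in> {0..1}" "\<gamma> \<in> paths X" "\<gamma> t \<in> U" by auto
    have "openin unit_interval {s \<in> topspace unit_interval. \<gamma> s \<in> U}"
      using w U unfolding paths_def pathin_def by (blast intro: openin_continuous_map_preimage)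
    then obtain e where e: "e > 0" "cball t e \<inter> {0..1} \<subseteq> {s \<in> {0..1}. \<gamma> s \<in> U}"
      using w by (auto simp: openin_contains_cball)
    let ?K = "cball t e \<inter> {0..1}"
    let ?T = "({0..1} \<inter> ball t e) \<times> {\<gamma> \<in> paths X. \<gamma> ` ?K \<subseteq> U}"
    have "openin (cylinder (path_topology X)) ?T"
      unfolding openin_prod_Times_iff
      by (intro disjI2 conjI openin_path_topology openin_open_Int U) (auto intro: compact_Int)
    moreover have "w \<in> ?T" using w e by auto
    moreover have "?T \<subseteq> ?W" by (auto simp: image_subset_iff)
    ultimately show "\<exists>T. openin (cylinder (path_topology X)) T \<and> w \<in> T \<and> T \<subseteq> ?W" by blast
  qed
qed

lemma G_spaceD:
  assumes "G_space \<alpha> X"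
  shows "Hausdorff_space X" "continuous_map (prod_topology euclidean X) X (\<lambda>(g, x). \<alpha> g x)"
    "\<And>x. x \<in> topspace X \<Longrightarrow> \<alpha> 0 x = x"
    "\<And>g h x. x \<in> topspace X \<Longrightarrow> \<alpha> (g + h) x = \<alpha> g (\<alpha> h x)"
    "\<And>g x. x \<in> topspace X \<Longrightarrow> \<alpha> g x \<in> topspace X"
  using assms by (auto simp: G_space_def continuous_map_def Pi_iff)

lemma continuous_map_fst_snd:
  "continuous_map (prod_topology X (prod_topology Y Z)) Y (\<lambda>w. fst (snd w))"
  by (rule continuous_map_compose[OF continuous_map_snd continuous_map_fst, unfolded o_def])

lemma continuous_map_snd_snd:
  "continuous_map (prod_topology X (prod_topology Y Z)) Z (\<lambda>w. snd (snd w))"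
  by (rule continuous_map_compose[OF continuous_map_snd continuous_map_snd, unfolded o_def])

lemma G_space_path_topology:
  fixes \<alpha> :: "'g::topological_group_add \<Rightarrow> 'a \<Rightarrow> 'a"
  assumes "G_space \<alpha> X"
  shows "G_space (path_act \<alpha>) (path_topology X)"
proof -
  note X = G_spaceD[OF assms]
  let ?GP = "prod_topology (euclidean :: 'g topology) (path_topology X)"
  have top: "\<gamma> t \<in> topspace X" if "\<gamma> \<in> paths X" "0 \<le> t" "t \<le> 1" for \<gamma> t
    using that by (auto simp: paths_def pathin_def continuous_map_def Pi_iff)
  have ev: "continuous_map (cylinder ?GP) X (\<lambda>w. case (fst w, snd (snd w)) of (t, \<gamma>) \<Rightarrow> \<gamma> t)"
    by (rule continuous_map_compose[OF _ continuous_map_path_eval, unfolded o_def])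
       (intro continuous_map_pairedI continuous_map_fst continuous_map_snd_snd)
  have "continuous_map (cylinder ?GP) X
          (\<lambda>w. case (fst (snd w), case (fst w, snd (snd w)) of (t, \<gamma>) \<Rightarrow> \<gamma> t) of (g, x) \<Rightarrow> \<alpha> g x)"
    by (rule continuous_map_compose[OF _ X(2), unfolded o_def])
       (intro continuous_map_pairedI ev continuous_map_fst_snd)
  from continuous_map_into_path_topology[OF this]
  have c: "continuous_map ?GP (path_topology X) (\<lambda>(g, \<gamma>). path_act \<alpha> g \<gamma>)"
    by (simp add: path_act_def case_prod_unfold)
  show ?thesis
    unfolding G_space_def
  proof (intro conjI allI ballI c Hausdorff_path_topology X(1))
    fix \<gamma> assume g: "\<gamma> \<in> topspace (path_topology X)"
    show "path_act \<alpha> 0 \<gamma> = \<gamma>"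
      using g top[of \<gamma>] X(3) by (intro extensionalityI[of _ "{0..1}"]) (auto simp: path_act_def paths_def)
    show "path_act \<alpha> (g + h) \<gamma> = path_act \<alpha> g (path_act \<alpha> h \<gamma>)" for g h
      using g top[of \<gamma>] X(4) by (intro extensionalityI[of _ "{0..1}"]) (auto simp: path_act_def)
  qed
qed

lemma G_space_prod_topology:
  fixes \<alpha> :: "'g::topological_group_add \<Rightarrow> 'a \<Rightarrow> 'a"
  assumes "G_space \<alpha> X" "G_space \<beta> Y"
  shows "G_space (prod_act \<alpha> \<beta>) (prod_topology X Y)"
proof -
  note X = G_spaceD[OF assms(1)] and Y = G_spaceD[OF assms(2)]
  let ?GP = "prod_topology (euclidean :: 'g topology) (prod_topology X Y)"
  have "continuous_map ?GP X (\<lambda>w. case (fst w, fst (snd w)) of (g, x) \<Rightarrow> \<alpha> g x)"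
    by (rule continuous_map_compose[OF _ X(2), unfolded o_def])
       (intro continuous_map_pairedI continuous_map_fst continuous_map_fst_snd)
  moreover have "continuous_map ?GP Y (\<lambda>w. case (fst w, snd (snd w)) of (g, x) \<Rightarrow> \<beta> g x)"
    by (rule continuous_map_compose[OF _ Y(2), unfolded o_def])
       (intro continuous_map_pairedI continuous_map_fst continuous_map_snd_snd)
  ultimately have "continuous_map ?GP (prod_topology X Y) (\<lambda>(g, x). prod_act \<alpha> \<beta> g x)"
    by (simp add: prod_act_def case_prod_unfold continuous_map_pairedI)
  then show ?thesis
    using X Y by (auto simp: G_space_def prod_act_def Hausdorff_space_prod_topology)
qed

lemma G_space_subtopology:
  fixes \<alpha> :: "'g::topological_group_add \<Rightarrow> 'a \<Rightarrow> 'a"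
  assumes "G_space \<alpha> X" "G_invariant \<alpha> (topspace X \<inter> S)"
  shows "G_space \<alpha> (subtopology X S)"
proof -
  note X = G_spaceD[OF assms(1)]
  have "prod_topology (euclidean :: 'g topology) (subtopology X S) =
        subtopology (prod_topology euclidean X) (UNIV \<times> S)"
    by (simp add: prod_topology_subtopology(2))
  then have "continuous_map (prod_topology euclidean (subtopology X S)) (subtopology X S)
          (\<lambda>(g, x). \<alpha> g x)"
    using assms(2) by (auto simp: continuous_map_in_subtopology G_invariant_def
        intro: continuous_map_from_subtopology X(2))
  then show ?thesis
    using X by (auto simp: G_space_def Hausdorff_space_subtopology)
qed

theorem G_fibration_imp_G_homotopy_lifting:
  fixes \<alpha> :: "'g::topological_group_add \<Rightarrow> 'e \<Rightarrow> 'e" and \<beta> :: "'g \<Rightarrow> 'b \<Rightarrow> 'b"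
  assumes E: "G_space \<alpha> E" and B: "G_space \<beta> B" and p: "G_fibration \<alpha> E \<beta> B p"
  shows "G_homotopy_lifting TYPE('z) \<alpha> E \<beta> B p"
proof -
  define N where "N = subtopology (prod_topology E (path_topology B)) {(e, \<omega>). p e = \<omega> 0}"
  define \<nu> where "\<nu> = prod_act \<alpha> (path_act \<beta>)"
  note ES = G_spaceD[OF E] and BS = G_spaceD[OF B]
  note PS = G_spaceD[OF G_space_path_topology[OF B]]
  have pE: "p (\<alpha> g e) = \<beta> g (p e)" if "e \<in> topspace E" for g e
    using p that by (auto simp: G_fibration_def G_map_def equivariant_on_def)
  have NG: "G_space \<nu> N"
    unfolding N_def \<nu>_def
  proof (intro G_space_subtopology G_space_prod_topology E G_space_path_topology B)
    show "G_invariant (prod_act \<alpha> (path_act \<beta>))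
            (topspace (prod_topology E (path_topology B)) \<inter> {(e, \<omega>). p e = \<omega> 0})"
      using ES(5) PS(5) pE by (auto simp: G_invariant_def prod_act_def path_act_def)
  qed
  have NE: "G_map \<nu> N \<alpha> E fst"
    unfolding G_map_def N_def \<nu>_def
    by (auto simp: equivariant_on_def prod_act_def
        intro!: continuous_map_from_subtopology continuous_map_fst)
  have ev: "continuous_map (cylinder N) B (\<lambda>w. case (fst w, snd (snd w)) of (t, \<gamma>) \<Rightarrow> \<gamma> t)"
    unfolding N_def
    by (rule continuous_map_compose[OF _ continuous_map_path_eval, unfolded o_def],
        intro continuous_map_pairedI continuous_map_fst
          continuous_map_compose[OF continuous_map_snd, unfolded o_def]
          continuous_map_from_subtopology continuous_map_snd)
  have NH: "G_map (cylinder_act \<nu>) (cylinder N) \<beta> B (\<lambda>w. snd (snd w) (fst w))"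
    using ev unfolding G_map_def \<nu>_def
    by (auto simp: equivariant_on_def prod_act_def path_act_def)
  have "\<forall>n\<in>topspace N. snd (snd (0, n)) (fst (0, n)) = p (fst n)"
    by (auto simp: N_def)
  then obtain L where L: "G_map (cylinder_act \<nu>) (cylinder N) \<alpha> E L"
      "\<forall>n\<in>topspace N. L (0, n) = fst n"
      "\<forall>w\<in>topspace (cylinder N). p (L w) = snd (snd w) (fst w)"
    using p NG NE NH unfolding G_fibration_def G_homotopy_lifting_def by blast
  show ?thesis
    unfolding G_homotopy_lifting_def
  proof (intro allI impI)
    fix Z :: "'z topology" and \<zeta> f H
    assume Z: "G_space \<zeta> Z" and f: "G_map \<zeta> Z \<alpha> E f"
      and H: "G_map (cylinder_act \<zeta>) (cylinder Z) \<beta> B H"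
      and H0: "\<forall>z\<in>topspace Z. H (0, z) = p (f z)"
    note ZS = G_spaceD[OF Z]
    define k where "k z = (f z, \<lambda>t\<in>{0..1}. H (t, z))" for z
    have "continuous_map Z (prod_topology E (path_topology B)) k"
      using f H unfolding k_def G_map_def
      by (intro continuous_map_pairedI continuous_map_into_path_topology) auto
    then have kc: "continuous_map Z N k"
      unfolding N_def continuous_map_in_subtopology using H0 by (auto simp: k_def)
    then have kt: "k z \<in> topspace N" if "z \<in> topspace Z" for z
      using that by (auto simp: continuous_map_def)
    have ke: "k (\<zeta> g z) = \<nu> g (k z)" if "z \<in> topspace Z" for g z
      using f H that
      by (auto simp: k_def \<nu>_def prod_act_def path_act_def G_map_def equivariant_on_def
          intro!: restrict_ext)
    let ?K = "\<lambda>w. L (fst w, k (snd w))"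
    have "continuous_map (cylinder Z) (cylinder N) (\<lambda>w. (fst w, k (snd w)))"
      by (intro continuous_map_pairedI continuous_map_fst
          continuous_map_compose[OF continuous_map_snd kc, unfolded o_def])
    then have "continuous_map (cylinder Z) E ?K"
      using L(1) unfolding G_map_def by (auto dest: continuous_map_compose simp: o_def)
    moreover have "equivariant_on (topspace (cylinder Z)) (cylinder_act \<zeta>) \<alpha> ?K"
      using L(1) ke kt by (auto simp: G_map_def equivariant_on_def prod_act_def)
    ultimately have "G_map (cylinder_act \<zeta>) (cylinder Z) \<alpha> E ?K"
      unfolding G_map_def by blast
    moreover have "\<forall>z\<in>topspace Z. ?K (0, z) = f z"
      using L(2) kt by (auto simp: k_def)
    moreover have "\<forall>w\<in>topspace (cylinder Z). p (?K w) = H w"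
      using L(3) kt by (auto simp: k_def)
    ultimately show "\<exists>K. G_map (cylinder_act \<zeta>) (cylinder Z) \<alpha> E K \<and>
             (\<forall>z\<in>topspace Z. K (0, z) = f z) \<and> (\<forall>w\<in>topspace (cylinder Z). p (K w) = H w)"
      by blast
  qed
qed

section \<open>Equivariant sectional category and parametrized topological complexity\<close>

text \<open>The infimum of the empty set of extended naturals is \<open>\<infinity>\<close>.\<close>

definition secat_G ::
  "('g \<Rightarrow> 'x \<Rightarrow> 'x) \<Rightarrow> 'x topology \<Rightarrow> ('g \<Rightarrow> 'y \<Rightarrow> 'y) \<Rightarrow> 'y topology \<Rightarrow> ('x \<Rightarrow> 'y) \<Rightarrow> enat" where
  "secat_G \<xi> X \<eta> Y q =
     Inf {enat k |k. 0 < k \<and>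
       (\<exists>U s. (\<Union>i<k. U i) = topspace Y \<and>
          (\<forall>i<k. openin Y (U i) \<and> G_invariant \<eta> (U i) \<and>
                 G_map \<eta> (subtopology Y (U i)) \<xi> X (s i) \<and>
                 G_homotopic \<eta> (subtopology Y (U i)) \<eta> Y (q \<circ> s i) (\<lambda>y. y)))}"

definition fibre_paths :: "'e topology \<Rightarrow> ('e \<Rightarrow> 'b) \<Rightarrow> (real \<Rightarrow> 'e) topology" where
  "fibre_paths E p = subtopology (path_topology E) {\<gamma>. \<exists>b. \<forall>t\<in>{0..1}. p (\<gamma> t) = b}"

definition fibre_product :: "'e topology \<Rightarrow> ('e \<Rightarrow> 'b) \<Rightarrow> ('e \<times> 'e) topology" where
  "fibre_product E p = subtopology (prod_topology E E) {(e, e'). p e = p e'}"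

definition TC_G :: "('g \<Rightarrow> 'e \<Rightarrow> 'e) \<Rightarrow> 'e topology \<Rightarrow> ('e \<Rightarrow> 'b) \<Rightarrow> enat" where
  "TC_G \<alpha> E p =
     secat_G (path_act \<alpha>) (fibre_paths E p) (prod_act \<alpha> \<alpha>) (fibre_product E p) (\<lambda>\<gamma>. (\<gamma> 0, \<gamma> 1))"

section \<open>Orbit spaces\<close>

definition orbit_of :: "('g \<Rightarrow> 'a \<Rightarrow> 'a) \<Rightarrow> 'a \<Rightarrow> 'a set" where
  "orbit_of \<alpha> x = range (\<lambda>g. \<alpha> g x)"

definition orbit_space :: "('g \<Rightarrow> 'a \<Rightarrow> 'a) \<Rightarrow> 'a topology \<Rightarrow> 'a set topology" where
  "orbit_space \<alpha> X =
     topology (\<lambda>V. V \<subseteq> orbit_of \<alpha> ` topspace X \<and> openin X {x \<in> topspace X. orbit_of \<alpha> x \<in> V})"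

lemma openin_orbit_space:
  "openin (orbit_space \<alpha> X) V \<longleftrightarrow>
     V \<subseteq> orbit_of \<alpha> ` topspace X \<and> openin X {x \<in> topspace X. orbit_of \<alpha> x \<in> V}"
proof -
  let ?P = "\<lambda>V. {x \<in> topspace X. orbit_of \<alpha> x \<in> V}"
  have "?P (S \<inter> T) = ?P S \<inter> ?P T" for S T by auto
  moreover have "?P (\<Union>\<K>) = \<Union>(?P ` \<K>)" for \<K> by auto
  ultimately have "istopology (\<lambda>V. V \<subseteq> orbit_of \<alpha> ` topspace X \<and> openin X (?P V))"
    unfolding istopology_def by (auto simp del: Union_iff intro!: openin_Union)
  then show ?thesis
    unfolding orbit_space_def by (simp add: topology_inverse')
qed

lemma topspace_orbit_space: "topspace (orbit_space \<alpha> X) = orbit_of \<alpha> ` topspace X"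
proof
  show "topspace (orbit_space \<alpha> X) \<subseteq> orbit_of \<alpha> ` topspace X"
    using openin_orbit_space openin_topspace by blast
  have "{x \<in> topspace X. orbit_of \<alpha> x \<in> orbit_of \<alpha> ` topspace X} = topspace X" by auto
  then show "orbit_of \<alpha> ` topspace X \<subseteq> topspace (orbit_space \<alpha> X)"
    by (intro openin_subset) (simp add: openin_orbit_space)
qed

lemma quotient_map_orbit_of: "quotient_map X (orbit_space \<alpha> X) (orbit_of \<alpha>)"
  unfolding quotient_map_def by (auto simp: topspace_orbit_space openin_orbit_space)

section \<open>Singular cohomology with coefficients in a commutative ring\<close>

text \<open>
  An \<open>n\<close>-cochain is an \<open>'r\<close>-valued function on the singular \<open>n\<close>-simplices, equivalently a homomorphism
  from singular \<open>n\<close>-chains to \<open>'r\<close>.  It is extended by \<open>0\<close> outside the singular simplices of the space.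
\<close>

type_synonym ('a, 'r) cochain = "((nat \<Rightarrow> real) \<Rightarrow> 'a) \<Rightarrow> 'r"

definition cochains :: "nat \<Rightarrow> 'a topology \<Rightarrow> ('a, 'r::comm_ring_1) cochain set" where
  "cochains n X = {c. \<forall>\<sigma>. \<not> singular_simplex n X \<sigma> \<longrightarrow> c \<sigma> = 0}"

definition coboundary :: "nat \<Rightarrow> 'a topology \<Rightarrow> ('a, 'r::comm_ring_1) cochain \<Rightarrow> ('a, 'r) cochain" where
  "coboundary n X c =
     (\<lambda>\<sigma>. if singular_simplex (Suc n) X \<sigma>
          then \<Sum>k\<le>Suc n. (-1) ^ k * c (singular_face (Suc n) k \<sigma>) else 0)"

definition cocycles :: "nat \<Rightarrow> 'a topology \<Rightarrow> ('a, 'r::comm_ring_1) cochain set" where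
  "cocycles n X = {c \<in> cochains n X. coboundary n X c = (\<lambda>\<sigma>. 0)}"

definition coboundaries :: "nat \<Rightarrow> 'a topology \<Rightarrow> ('a, 'r::comm_ring_1) cochain set" where
  "coboundaries n X = (case n of 0 \<Rightarrow> {\<lambda>\<sigma>. 0} | Suc m \<Rightarrow> coboundary m X ` cochains m X)"

definition coh_class ::
  "nat \<Rightarrow> 'a topology \<Rightarrow> ('a, 'r::comm_ring_1) cochain \<Rightarrow> ('a, 'r) cochain set" where
  "coh_class n X c = {\<lambda>\<sigma>. c \<sigma> + b \<sigma> |b. b \<in> coboundaries n X}"

definition cohomology_group :: "nat \<Rightarrow> 'a topology \<Rightarrow> ('a, 'r::comm_ring_1) cochain set set" where
  "cohomology_group n X = coh_class n X ` cocycles n X"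

text \<open>
  The cohomology ring is the direct sum of the cohomology groups; its elements are the families of
  classes, indexed by degree, with only finitely many nonzero members.
\<close>

type_synonym ('a, 'r) coh_family = "nat \<Rightarrow> ('a, 'r) cochain set"

definition coh_zero :: "'a topology \<Rightarrow> ('a, 'r::comm_ring_1) coh_family" where
  "coh_zero X = (\<lambda>n. coh_class n X (\<lambda>\<sigma>. 0))"

definition cohomology :: "'a topology \<Rightarrow> ('a, 'r::comm_ring_1) coh_family set" where
  "cohomology X = {u. (\<forall>n. u n \<in> cohomology_group n X) \<and> finite {n. u n \<noteq> coh_zero X n}}"

definition coh_one :: "'a topology \<Rightarrow> ('a, 'r::comm_ring_1) coh_family" where
  "coh_one X =
     (coh_zero X)(0 := coh_class 0 X (\<lambda>\<sigma>. if singular_simplex 0 X \<sigma> then 1 else 0))"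

text \<open>
  The front \<open>i\<close>-face and the back \<open>j\<close>-face of a singular \<open>(i + j)\<close>-simplex.  Barycentric coordinates
  beyond the dimension vanish, so the standard \<open>i\<close>-simplex is itself the front face of the standard
  \<open>(i + j)\<close>-simplex.
\<close>

definition front_face :: "nat \<Rightarrow> ((nat \<Rightarrow> real) \<Rightarrow> 'a) \<Rightarrow> (nat \<Rightarrow> real) \<Rightarrow> 'a" where
  "front_face i \<sigma> = restrict \<sigma> (standard_simplex i)"

definition simplex_shift :: "nat \<Rightarrow> (nat \<Rightarrow> real) \<Rightarrow> nat \<Rightarrow> real" where
  "simplex_shift i x = (\<lambda>m. if m < i then 0 else x (m - i))"

definition back_face :: "nat \<Rightarrow> nat \<Rightarrow> ((nat \<Rightarrow> real) \<Rightarrow> 'a) \<Rightarrow> (nat \<Rightarrow> real) \<Rightarrow> 'a" where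
  "back_face i j \<sigma> = restrict (\<sigma> \<circ> simplex_shift i) (standard_simplex j)"

definition cochain_cup ::
  "nat \<Rightarrow> nat \<Rightarrow> 'a topology \<Rightarrow> ('a, 'r::comm_ring_1) cochain \<Rightarrow> ('a, 'r) cochain \<Rightarrow> ('a, 'r) cochain" where
  "cochain_cup i j X c d =
     (\<lambda>\<sigma>. if singular_simplex (i + j) X \<sigma> then c (front_face i \<sigma>) * d (back_face i j \<sigma>) else 0)"

text \<open>
  The cup product is defined by means of all choices of representatives; \<open>cup_coh_class\<close> below
  shows that it does not depend on the choice.
\<close>

definition cup ::
  "'a topology \<Rightarrow> ('a, 'r::comm_ring_1) coh_family \<Rightarrow> ('a, 'r) coh_family \<Rightarrow> ('a, 'r) coh_family" where
  "cup X u v =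
     (\<lambda>n. \<Union>{coh_class n X (\<lambda>\<sigma>. \<Sum>i\<le>n. cochain_cup i (n - i) X (c i) (d (n - i)) \<sigma>) |c d.
            \<forall>i\<le>n. c i \<in> u i \<and> d i \<in> v i})"

definition cup_list :: "'a topology \<Rightarrow> ('a, 'r::comm_ring_1) coh_family list \<Rightarrow> ('a, 'r) coh_family" where
  "cup_list X us = foldr (cup X) us (coh_one X)"

definition cochain_pullback ::
  "nat \<Rightarrow> 'a topology \<Rightarrow> ('a \<Rightarrow> 'b) \<Rightarrow> ('b, 'r::comm_ring_1) cochain \<Rightarrow> ('a, 'r) cochain" where
  "cochain_pullback n X f c = (\<lambda>\<sigma>. if singular_simplex n X \<sigma> then c (simplex_map n f \<sigma>) else 0)"

definition coh_induced ::
  "'a topology \<Rightarrow> ('a \<Rightarrow> 'b) \<Rightarrow> ('b, 'r::comm_ring_1) coh_family \<Rightarrow> ('a, 'r) coh_family" where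
  "coh_induced X f u = (\<lambda>n. \<Union>c\<in>u n. coh_class n X (cochain_pullback n X f c))"

abbreviation coh_restrict ::
  "'a topology \<Rightarrow> 'a set \<Rightarrow> ('a, 'r::comm_ring_1) coh_family \<Rightarrow> ('a, 'r) coh_family" where
  "coh_restrict X A \<equiv> coh_induced (subtopology X A) (\<lambda>x. x)"

subsection \<open>Independence of the choice of representatives\<close>

lemma coboundary_coboundary: "coboundary (Suc n) X (coboundary n X c) = (\<lambda>\<sigma>. 0)"
proof
  fix \<sigma>
  show "coboundary (Suc n) X (coboundary n X c) \<sigma> = 0"
  proof (cases "singular_simplex (Suc (Suc n)) X \<sigma>")
    case True
    have faces: "singular_simplex (Suc n) X (singular_face (Suc (Suc n)) k \<sigma>)" if "k \<le> Suc (Suc n)" for k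
      using singular_simplex_singular_face[OF True _ that] by simp
    have eqf: "singular_face (Suc n) i (singular_face (Suc (Suc n)) (Suc j) \<sigma>) =
               singular_face (Suc n) j (singular_face (Suc (Suc n)) i \<sigma>)" if "i \<le> j" "j \<le> Suc n" for i j
    proof
      fix t
      show "singular_face (Suc n) i (singular_face (Suc (Suc n)) (Suc j) \<sigma>) t =
            singular_face (Suc n) j (singular_face (Suc (Suc n)) i \<sigma>) t"
      proof (cases "t \<in> standard_simplex n")
        case True
        have "simplical_face i t \<in> standard_simplex (Suc n)"
          using simplical_face_in_standard_simplex[of "Suc n" i t] True that by simp
        moreover have "simplical_face j t \<in> standard_simplex (Suc n)"
          using simplical_face_in_standard_simplex[of "Suc n" j t] True that by simp
        moreover have "simplical_face (Suc j) (simplical_face i t) = simplical_face i (simplical_face j t)"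
          using that unfolding simplical_face_def by fastforce
        ultimately show ?thesis by (simp add: singular_face_def)
      qed (simp add: singular_face_def)
    qed
    let ?f = "\<lambda>(k, l). (-1) ^ (k + l) * c (singular_face (Suc n) l (singular_face (Suc (Suc n)) k \<sigma>))"
    let ?P = "{..Suc (Suc n)} \<times> {..Suc n}"
    let ?D = "{(i, j). i \<le> j \<and> j \<le> Suc n}"
    have "coboundary (Suc n) X (coboundary n X c) \<sigma> = sum ?f ?P"
      using True faces
      by (simp add: coboundary_def sum_distrib_left sum.cartesian_product[symmetric] power_add mult.assoc
          del: sum.atMost_Suc)
    also have "\<dots> = sum ?f (?P \<inter> {(x, y). y < x}) + sum ?f (?P - {(x, y). y < x})"
      by (rule sum.Int_Diff) simp
    also have "?P \<inter> {(x, y). y < x} = (\<lambda>(j, i). (Suc i, j)) ` ?D"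
    proof (intro equalityI subsetI)
      fix w assume "w \<in> ?P \<inter> {(x, y). y < x}"
      then obtain x y where w: "w = (x, y)" "x \<le> Suc (Suc n)" "y < x" by auto
      then have "(y, x - 1) \<in> ?D" "w = (\<lambda>(j, i). (Suc i, j)) (y, x - 1)" by auto
      then show "w \<in> (\<lambda>(j, i). (Suc i, j)) ` ?D" by (rule rev_image_eqI)
    qed auto
    also have "?P - {(x, y). y < x} = ?D"
      by auto
    also have "sum ?f ((\<lambda>(j, i). (Suc i, j)) ` ?D) = - sum ?f ?D"
    proof -
      have "sum ?f ((\<lambda>(j, i). (Suc i, j)) ` ?D) = sum (?f \<circ> (\<lambda>(j, i). (Suc i, j))) ?D"
        by (rule sum.reindex) (auto simp: inj_on_def)
      also have "\<dots> = (\<Sum>w\<in>?D. - ?f w)"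
      proof (rule sum.cong)
        fix w assume "w \<in> ?D"
        then obtain i j where w: "w = (i, j)" and "i \<le> j" "j \<le> Suc n" by auto
        then show "(?f \<circ> (\<lambda>(j, i). (Suc i, j))) w = - ?f w"
          using eqf[of i j] by (simp add: w add.commute)
      qed simp
      finally show ?thesis by (simp only: sum_negf)
    qed
    finally show ?thesis by simp
  qed (simp add: coboundary_def)
qed

lemma coboundary_in_cochains: "coboundary n X c \<in> cochains (Suc n) X"
  by (simp add: cochains_def coboundary_def)

lemma coboundary_add: "coboundary n X (\<lambda>\<sigma>. c \<sigma> + d \<sigma>) = (\<lambda>\<sigma>. coboundary n X c \<sigma> + coboundary n X d \<sigma>)"
proof -
  have "(\<Sum>k\<le>m. (-1) ^ k * (f k + g k)) = (\<Sum>k\<le>m. (-1) ^ k * f k) + (\<Sum>k\<le>m. (-1) ^ k * g k)"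
    for m and f g :: "nat \<Rightarrow> 'b"
    by (simp only: distrib_left sum.distrib)
  then show ?thesis by (simp add: coboundary_def fun_eq_iff del: sum.atMost_Suc)
qed

lemma coboundary_scale: "coboundary n X (\<lambda>\<sigma>. r * c \<sigma>) = (\<lambda>\<sigma>. r * coboundary n X c \<sigma>)"
proof -
  have "(\<Sum>k\<le>m. (-1) ^ k * (r * f k)) = r * (\<Sum>k\<le>m. (-1) ^ k * f k)" for m and f :: "nat \<Rightarrow> 'b"
    by (simp only: sum_distrib_left mult.left_commute[of _ r])
  then show ?thesis by (simp add: coboundary_def fun_eq_iff del: sum.atMost_Suc)
qed

lemma zero_in_coboundaries: "((\<lambda>\<sigma>. 0) :: ('a, 'r::comm_ring_1) cochain) \<in> coboundaries n X"
proof (cases n)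
  case (Suc m)
  have "coboundary m X (\<lambda>\<sigma>. 0 :: 'r) = (\<lambda>\<sigma>. 0)" by (simp add: coboundary_def fun_eq_iff)
  moreover have "coboundary m X (\<lambda>\<sigma>. 0 :: 'r) \<in> coboundary m X ` cochains m X"
    by (rule imageI) (simp add: cochains_def)
  ultimately show ?thesis by (simp add: coboundaries_def Suc)
qed (simp add: coboundaries_def)

lemma coboundaries_add:
  assumes "a \<in> coboundaries n X" "b \<in> coboundaries n X"
  shows "(\<lambda>\<sigma>. a \<sigma> + b \<sigma>) \<in> coboundaries n X"
proof (cases n)
  case (Suc m)
  then obtain e f where "e \<in> cochains m X" "f \<in> cochains m X" "a = coboundary m X e" "b = coboundary m X f"
    using assms by (auto simp: coboundaries_def)
  then show ?thesis
    unfolding coboundaries_def Suc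
    by (auto simp: cochains_def coboundary_add intro!: image_eqI[of _ _ "\<lambda>\<sigma>. e \<sigma> + f \<sigma>"])
qed (use assms in \<open>simp add: coboundaries_def\<close>)

lemma coboundaries_scale:
  assumes "a \<in> coboundaries n X"
  shows "(\<lambda>\<sigma>. r * a \<sigma>) \<in> coboundaries n X"
proof (cases n)
  case (Suc m)
  then obtain e where "e \<in> cochains m X" "a = coboundary m X e"
    using assms by (auto simp: coboundaries_def)
  then show ?thesis
    unfolding coboundaries_def Suc
    by (auto simp: cochains_def coboundary_scale intro!: image_eqI[of _ _ "\<lambda>\<sigma>. r * e \<sigma>"])
qed (use assms in \<open>simp add: coboundaries_def\<close>)

lemma coboundaries_sum:
  assumes "finite I" "\<And>i. i \<in> I \<Longrightarrow> a i \<in> coboundaries n X"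
  shows "(\<lambda>\<sigma>. \<Sum>i\<in>I. a i \<sigma>) \<in> coboundaries n X"
  using assms by (induction I rule: finite_induct) (auto simp: zero_in_coboundaries coboundaries_add)

lemma coboundaries_subset_cocycles: "coboundaries n X \<subseteq> cocycles n X"
proof (cases n)
  case 0
  then show ?thesis by (auto simp: coboundaries_def cocycles_def cochains_def coboundary_def)
next
  case (Suc m)
  then show ?thesis
    by (auto simp: coboundaries_def cocycles_def coboundary_in_cochains coboundary_coboundary)
qed

lemma cocycles_add: "c \<in> cocycles n X \<Longrightarrow> d \<in> cocycles n X \<Longrightarrow> (\<lambda>\<sigma>. c \<sigma> + d \<sigma>) \<in> cocycles n X"
  by (auto simp: cocycles_def cochains_def coboundary_add)

lemma coh_class_cong:
  assumes "b \<in> coboundaries n X"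
  shows "coh_class n X (\<lambda>\<sigma>. c \<sigma> + b \<sigma>) = coh_class n X c"
proof -
  have sub: "coh_class n X (\<lambda>\<sigma>. c \<sigma> + b \<sigma>) \<subseteq> coh_class n X c" if "b \<in> coboundaries n X" for b c
    unfolding coh_class_def using coboundaries_add[OF that] by (force simp: add.assoc)
  moreover have "(\<lambda>\<sigma>. - b \<sigma>) \<in> coboundaries n X"
    using coboundaries_scale[OF assms, of "-1"] by simp
  from sub[OF this, of "\<lambda>\<sigma>. c \<sigma> + b \<sigma>"]
  have "coh_class n X c \<subseteq> coh_class n X (\<lambda>\<sigma>. c \<sigma> + b \<sigma>)" by simp
  ultimately show ?thesis using assms by blast
qed

lemma simplex_shift_in_standard_simplex:
  assumes "x \<in> standard_simplex j"
  shows "simplex_shift i x \<in> standard_simplex (i + j)"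
proof -
  have "(\<Sum>m\<le>i + j. simplex_shift i x m) = (\<Sum>m\<in>{i..i + j}. simplex_shift i x m)"
    by (rule sum.mono_neutral_right) (auto simp: simplex_shift_def)
  also have "\<dots> = (\<Sum>m\<le>j. x m)"
    by (rule sum.reindex_bij_witness[of _ "\<lambda>m. m + i" "\<lambda>m. m - i"]) (auto simp: simplex_shift_def)
  finally show ?thesis
    using assms by (auto simp: standard_simplex_def simplex_shift_def)
qed

lemma standard_simplex_le:
  assumes "x \<in> standard_simplex i" "i \<le> n"
  shows "x \<in> standard_simplex n"
proof -
  have "(\<Sum>m\<le>n. x m) = (\<Sum>m\<le>i. x m)"
    using assms by (intro sum.mono_neutral_right) (auto simp: standard_simplex_def)
  then show ?thesis using assms by (auto simp: standard_simplex_def)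
qed

lemma singular_simplex_front_face:
  assumes "singular_simplex (i + j) X \<sigma>"
  shows "singular_simplex i X (front_face i \<sigma>)"
proof -
  have "standard_simplex i \<subseteq> standard_simplex (i + j)" using standard_simplex_le by auto
  then have "continuous_map (subtopology (powertop_real UNIV) (standard_simplex i)) X \<sigma>"
    using assms continuous_map_from_subtopology_mono unfolding singular_simplex_def by blast
  then have "continuous_map (subtopology (powertop_real UNIV) (standard_simplex i)) X (front_face i \<sigma>)"
    by (rule continuous_map_eq) (auto simp: front_face_def)
  then show ?thesis by (simp add: singular_simplex_def front_face_def)
qed

lemma singular_simplex_back_face:
  assumes "singular_simplex (i + j) X \<sigma>"
  shows "singular_simplex j X (back_face i j \<sigma>)"
proof -
  let ?T = "\<lambda>k. subtopology (powertop_real UNIV) (standard_simplex k)"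
  have "continuous_map (powertop_real UNIV) euclideanreal (\<lambda>x. simplex_shift i x m)" for m
    by (cases "m < i") (auto simp: simplex_shift_def intro: continuous_map_product_projection)
  then have "continuous_map (powertop_real UNIV) (powertop_real UNIV) (simplex_shift i)"
    by (simp add: continuous_map_componentwise_UNIV)
  then have "continuous_map (?T j) (?T (i + j)) (simplex_shift i)"
    using simplex_shift_in_standard_simplex
    by (auto simp: continuous_map_in_subtopology continuous_map_from_subtopology)
  then have "continuous_map (?T j) X (\<sigma> \<circ> simplex_shift i)"
    using assms by (auto simp: singular_simplex_def intro: continuous_map_compose)
  then have "continuous_map (?T j) X (back_face i j \<sigma>)"
    by (rule continuous_map_eq) (auto simp: back_face_def)
  then show ?thesis by (simp add: singular_simplex_def back_face_def)
qed

lemma front_face_singular_face_le: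
  assumes "k \<le> Suc i"
  shows "front_face i (singular_face (Suc (i + j)) k \<sigma>) = singular_face (Suc i) k (front_face (Suc i) \<sigma>)"
proof
  fix t
  show "front_face i (singular_face (Suc (i + j)) k \<sigma>) t = singular_face (Suc i) k (front_face (Suc i) \<sigma>) t"
  proof (cases "t \<in> standard_simplex i")
    case True
    then have "t \<in> standard_simplex (i + j)" "simplical_face k t \<in> standard_simplex (Suc i)"
      using standard_simplex_le simplical_face_in_standard_simplex[of "Suc i" k t] assms by auto
    then show ?thesis using True by (simp add: front_face_def singular_face_def)
  qed (simp add: front_face_def singular_face_def)
qed

lemma front_face_singular_face_gt:
  assumes "i < k"
  shows "front_face i (singular_face (Suc (i + j)) k \<sigma>) = front_face i \<sigma>"
proof
  fix t
  show "front_face i (singular_face (Suc (i + j)) k \<sigma>) t = front_face i \<sigma> t"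
  proof (cases "t \<in> standard_simplex i")
    case True
    then have "t \<in> standard_simplex (i + j)" using standard_simplex_le by auto
    moreover have "simplical_face k t = t"
      using True assms by (intro ext) (auto simp: simplical_face_def standard_simplex_def)
    ultimately show ?thesis using True by (simp add: front_face_def singular_face_def)
  qed (simp add: front_face_def)
qed

lemma back_face_singular_face_le:
  assumes "k \<le> i"
  shows "back_face i j (singular_face (Suc (i + j)) k \<sigma>) = back_face (Suc i) j \<sigma>"
proof
  fix t
  have "simplical_face k (simplex_shift i t) = simplex_shift (Suc i) t"
    using assms by (intro ext) (auto simp: simplical_face_def simplex_shift_def)
  then show "back_face i j (singular_face (Suc (i + j)) k \<sigma>) t = back_face (Suc i) j \<sigma> t"
    using simplex_shift_in_standard_simplex[of t j i] by (simp add: back_face_def singular_face_def restrict_def)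
qed

lemma back_face_singular_face_ge:
  assumes "l \<le> Suc j"
  shows "back_face i j (singular_face (Suc (i + j)) (i + l) \<sigma>) = singular_face (Suc j) l (back_face i (Suc j) \<sigma>)"
proof
  fix t
  have "simplical_face (i + l) (simplex_shift i t) = simplex_shift i (simplical_face l t)"
    by (intro ext) (auto simp: simplical_face_def simplex_shift_def)
  then show "back_face i j (singular_face (Suc (i + j)) (i + l) \<sigma>) t =
             singular_face (Suc j) l (back_face i (Suc j) \<sigma>) t"
    using simplex_shift_in_standard_simplex[of t j i] simplical_face_in_standard_simplex[of "Suc j" l t] assms
    by (simp add: back_face_def singular_face_def restrict_def)
qed

lemma coboundary_cochain_cup:
  "coboundary (i + j) X (cochain_cup i j X c d) =
     (\<lambda>\<sigma>. cochain_cup (Suc i) j X (coboundary i X c) d \<sigma> +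
          (-1) ^ i * cochain_cup i (Suc j) X c (coboundary j X d) \<sigma>)"
proof
  fix \<sigma>
  show "coboundary (i + j) X (cochain_cup i j X c d) \<sigma> =
     cochain_cup (Suc i) j X (coboundary i X c) d \<sigma> +
          (-1) ^ i * cochain_cup i (Suc j) X c (coboundary j X d) \<sigma>"
  proof (cases "singular_simplex (Suc (i + j)) X \<sigma>")
    case True
    let ?s = "\<lambda>k. singular_face (Suc (i + j)) k \<sigma>"
    let ?g = "\<lambda>k. (-1) ^ k * (c (front_face i (?s k)) * d (back_face i j (?s k)))"
    have faces: "singular_simplex (i + j) X (?s k)" if "k \<le> Suc (i + j)" for k
      using singular_simplex_singular_face[OF True _ that] by simp
    have frt: "singular_simplex (Suc i) X (front_face (Suc i) \<sigma>)"
      using True singular_simplex_front_face[of "Suc i" j] by simp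
    have bck: "singular_simplex (Suc j) X (back_face i (Suc j) \<sigma>)"
      using True singular_simplex_back_face[of i "Suc j"] by simp
    have "coboundary (i + j) X (cochain_cup i j X c d) \<sigma> = (\<Sum>k\<le>Suc (i + j). ?g k)"
      using True faces by (simp add: coboundary_def cochain_cup_def del: sum.atMost_Suc)
    also have "{..Suc (i + j)} = {..i} \<union> {Suc i..Suc (i + j)}"
      by auto
    also have "sum ?g \<dots> = (\<Sum>k\<le>i. ?g k) + (\<Sum>k\<in>{Suc i..Suc (i + j)}. ?g k)"
      by (rule sum.union_disjoint) auto
    also have "(\<Sum>k\<in>{Suc i..Suc (i + j)}. ?g k) = (\<Sum>l\<le>j. ?g (i + Suc l))"
      by (rule sum.reindex_bij_witness[of _ "\<lambda>l. i + Suc l" "\<lambda>k. k - Suc i"]) auto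
    also have "\<dots> = (\<Sum>l\<le>j. (-1) ^ (i + Suc l) *
                (c (front_face i \<sigma>) * d (singular_face (Suc j) (Suc l) (back_face i (Suc j) \<sigma>))))"
      by (intro sum.cong refl, subst back_face_singular_face_ge, simp, subst front_face_singular_face_gt) auto
    finally have L: "coboundary (i + j) X (cochain_cup i j X c d) \<sigma> = (\<Sum>k\<le>i. ?g k) +
        (\<Sum>l\<le>j. (-1) ^ (i + Suc l) *
                (c (front_face i \<sigma>) * d (singular_face (Suc j) (Suc l) (back_face i (Suc j) \<sigma>))))" .
    have f: "singular_face (Suc i) (Suc i) (front_face (Suc i) \<sigma>) = front_face i \<sigma>"
      using front_face_singular_face_le[of "Suc i" i j \<sigma>] front_face_singular_face_gt[of i "Suc i" j \<sigma>] by simp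
    have b: "singular_face (Suc j) 0 (back_face i (Suc j) \<sigma>) = back_face (Suc i) j \<sigma>"
      using back_face_singular_face_le[of i i j \<sigma>] back_face_singular_face_ge[of 0 j i \<sigma>] by simp
    have "cochain_cup (Suc i) j X (coboundary i X c) d \<sigma> =
          (\<Sum>k\<le>Suc i. (-1) ^ k * (c (singular_face (Suc i) k (front_face (Suc i) \<sigma>)) * d (back_face (Suc i) j \<sigma>)))"
      using True frt
      by (simp add: cochain_cup_def coboundary_def sum_distrib_right mult.assoc del: sum.atMost_Suc)
    also have "\<dots> = (\<Sum>k\<le>i. ?g k) + (-1) ^ Suc i * (c (front_face i \<sigma>) * d (back_face (Suc i) j \<sigma>))"
      by (simp add: f front_face_singular_face_le back_face_singular_face_le)
    finally have R1: "cochain_cup (Suc i) j X (coboundary i X c) d \<sigma> =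
        (\<Sum>k\<le>i. ?g k) + (-1) ^ Suc i * (c (front_face i \<sigma>) * d (back_face (Suc i) j \<sigma>))" .
    have "cochain_cup i (Suc j) X c (coboundary j X d) \<sigma> =
          (\<Sum>l\<le>Suc j. (-1) ^ l * (c (front_face i \<sigma>) * d (singular_face (Suc j) l (back_face i (Suc j) \<sigma>))))"
      using True bck
      by (simp add: cochain_cup_def coboundary_def sum_distrib_left mult.left_commute del: sum.atMost_Suc)
    also have "\<dots> = c (front_face i \<sigma>) * d (back_face (Suc i) j \<sigma>) +
          (\<Sum>l\<le>j. (-1) ^ Suc l * (c (front_face i \<sigma>) * d (singular_face (Suc j) (Suc l) (back_face i (Suc j) \<sigma>))))"
      by (simp only: sum.atMost_Suc_shift b) simp
    finally have R2: "cochain_cup i (Suc j) X c (coboundary j X d) \<sigma> =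
        c (front_face i \<sigma>) * d (back_face (Suc i) j \<sigma>) +
          (\<Sum>l\<le>j. (-1) ^ Suc l * (c (front_face i \<sigma>) * d (singular_face (Suc j) (Suc l) (back_face i (Suc j) \<sigma>))))" .
    show ?thesis
      unfolding L R1 R2 by (simp add: distrib_left sum_distrib_left power_add mult.assoc)
  qed (simp add: coboundary_def cochain_cup_def)
qed

lemma cochain_cup_in_cochains: "cochain_cup i j X c d \<in> cochains (i + j) X"
  by (simp add: cochain_cup_def cochains_def)

lemma cochain_cup_zero:
  "cochain_cup i j X (\<lambda>\<sigma>. 0) d = (\<lambda>\<sigma>. 0)" "cochain_cup i j X c (\<lambda>\<sigma>. 0) = (\<lambda>\<sigma>. 0)"
  by (auto simp: cochain_cup_def)

lemma cochain_cup_coboundary_left: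
  assumes a: "a \<in> coboundaries i X" and d: "d \<in> cocycles j X"
  shows "cochain_cup i j X a d \<in> coboundaries (i + j) X"
proof (cases i)
  case 0
  then show ?thesis using a zero_in_coboundaries by (auto simp: coboundaries_def cochain_cup_zero)
next
  case (Suc m)
  then obtain e where e: "e \<in> cochains m X" "a = coboundary m X e"
    using a by (auto simp: coboundaries_def)
  have "coboundary (m + j) X (cochain_cup m j X e d) = cochain_cup i j X a d"
    using d by (simp add: coboundary_cochain_cup e Suc cocycles_def cochain_cup_zero)
  then show ?thesis
    using cochain_cup_in_cochains[of m j X e d] unfolding coboundaries_def Suc
    by (simp add: rev_image_eqI)
qed

lemma cochain_cup_coboundary_right:
  assumes c: "c \<in> cocycles i X" and b: "b \<in> coboundaries j X"
  shows "cochain_cup i j X c b \<in> coboundaries (i + j) X"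
proof (cases j)
  case 0
  then show ?thesis using b zero_in_coboundaries[of i X] by (auto simp: coboundaries_def cochain_cup_zero)
next
  case (Suc m)
  then obtain e where e: "e \<in> cochains m X" "b = coboundary m X e"
    using b by (auto simp: coboundaries_def)
  have "coboundary (i + m) X (cochain_cup i m X c e) = (\<lambda>\<sigma>. (-1) ^ i * cochain_cup i j X c b \<sigma>)"
    using c by (simp add: coboundary_cochain_cup e Suc cocycles_def cochain_cup_zero)
  then have "(\<lambda>\<sigma>. (-1) ^ i * cochain_cup i j X c b \<sigma>) \<in> coboundaries (i + j) X"
    using cochain_cup_in_cochains[of i m X c e] unfolding coboundaries_def Suc
    by (simp add: rev_image_eqI)
  from coboundaries_scale[OF this, of "(-1) ^ i"] show ?thesis
    by (simp flip: mult.assoc power_add)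
qed

theorem cup_coh_class:
  assumes c: "\<And>i. i \<le> n \<Longrightarrow> c i \<in> cocycles i X" and d: "\<And>i. i \<le> n \<Longrightarrow> d i \<in> cocycles i X"
  shows "cup X (\<lambda>i. coh_class i X (c i)) (\<lambda>i. coh_class i X (d i)) n =
         coh_class n X (\<lambda>\<sigma>. \<Sum>i\<le>n. cochain_cup i (n - i) X (c i) (d (n - i)) \<sigma>)"
    (is "_ = ?rhs")
proof -
  have self: "c i \<in> coh_class i X (c i)" for i and c :: "nat \<Rightarrow> ('a, 'b) cochain"
    unfolding coh_class_def using zero_in_coboundaries by force
  have "coh_class n X (\<lambda>\<sigma>. \<Sum>i\<le>n. cochain_cup i (n - i) X (c' i) (d' (n - i)) \<sigma>) = ?rhs"
    if *: "\<forall>i\<le>n. c' i \<in> coh_class i X (c i) \<and> d' i \<in> coh_class i X (d i)" for c' d'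
  proof -
    define a where "a i = (\<lambda>\<sigma>. c' i \<sigma> - c i \<sigma>)" for i
    define b where "b i = (\<lambda>\<sigma>. d' i \<sigma> - d i \<sigma>)" for i
    have a: "a i \<in> coboundaries i X \<and> c' i = (\<lambda>\<sigma>. c i \<sigma> + a i \<sigma>)"
      and b: "b i \<in> coboundaries i X \<and> d' i = (\<lambda>\<sigma>. d i \<sigma> + b i \<sigma>)" if "i \<le> n" for i
      using * that by (auto simp: a_def b_def coh_class_def)
    define e where "e i = (\<lambda>\<sigma>. cochain_cup i (n - i) X (a i) (d' (n - i)) \<sigma> +
                              cochain_cup i (n - i) X (c i) (b (n - i)) \<sigma>)" for i
    have d': "d' i \<in> cocycles i X" if "i \<le> n" for i
    proof -
      have "b i \<in> cocycles i X" using b[OF that] coboundaries_subset_cocycles by blast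
      then show ?thesis using b[OF that] cocycles_add[OF d[OF that]] by simp
    qed
    have e: "e i \<in> coboundaries n X" if "i \<le> n" for i
      using cochain_cup_coboundary_left[of "a i" i X "d' (n - i)" "n - i"] a[OF that] d'[of "n - i"]
        cochain_cup_coboundary_right[of "c i" i X "b (n - i)" "n - i"] b[of "n - i"] c[OF that] that
      unfolding e_def by (auto intro: coboundaries_add)
    have "cochain_cup i (n - i) X (c' i) (d' (n - i)) \<sigma> =
          cochain_cup i (n - i) X (c i) (d (n - i)) \<sigma> + e i \<sigma>" if "i \<le> n" for i \<sigma>
    proof -
      have "c' i = (\<lambda>\<sigma>. c i \<sigma> + a i \<sigma>)" "d' (n - i) = (\<lambda>\<sigma>. d (n - i) \<sigma> + b (n - i) \<sigma>)"
        using a[OF that] b[of "n - i"] by simp_all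
      then show ?thesis by (simp add: e_def cochain_cup_def distrib_left distrib_right)
    qed
    then have "(\<lambda>\<sigma>. \<Sum>i\<le>n. cochain_cup i (n - i) X (c' i) (d' (n - i)) \<sigma>) =
          (\<lambda>\<sigma>. (\<Sum>i\<le>n. cochain_cup i (n - i) X (c i) (d (n - i)) \<sigma>) + (\<Sum>i\<le>n. e i \<sigma>))"
      by (simp add: sum.distrib)
    then show ?thesis
      using coh_class_cong[OF coboundaries_sum[of "{..n}" e n X]] e by simp
  qed
  note eq = this
  show ?thesis
  proof (intro equalityI subsetI)
    fix z assume "z \<in> cup X (\<lambda>i. coh_class i X (c i)) (\<lambda>i. coh_class i X (d i)) n"
    then obtain c' d' where "\<forall>i\<le>n. c' i \<in> coh_class i X (c i) \<and> d' i \<in> coh_class i X (d i)"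
      "z \<in> coh_class n X (\<lambda>\<sigma>. \<Sum>i\<le>n. cochain_cup i (n - i) X (c' i) (d' (n - i)) \<sigma>)"
      unfolding cup_def by (elim UnionE CollectE exE conjE) simp
    then show "z \<in> ?rhs" using eq by simp
  next
    fix z assume z: "z \<in> ?rhs"
    show "z \<in> cup X (\<lambda>i. coh_class i X (c i)) (\<lambda>i. coh_class i X (d i)) n"
      unfolding cup_def
      by (rule UnionI[OF _ z], rule CollectI, intro exI[of _ c] exI[of _ d]) (simp add: self)
  qed
qed

lemma coboundary_cochain_pullback:
  assumes "continuous_map X Y f"
  shows "coboundary n X (cochain_pullback n X f c) = cochain_pullback (Suc n) X f (coboundary n Y c)"
proof
  fix \<sigma>
  have "simplex_map n f (singular_face (Suc n) k \<sigma>) = singular_face (Suc n) k (simplex_map (Suc n) f \<sigma>)"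
    if "k \<le> Suc n" for k
  proof -
    have "simplical_face k t \<in> standard_simplex (Suc n)" if "t \<in> standard_simplex n" for t
      using simplical_face_in_standard_simplex[of "Suc n" k t] that \<open>k \<le> Suc n\<close> by simp
    then show ?thesis
      by (auto simp: simplex_map_def singular_face_def restrict_def fun_eq_iff)
  qed
  then show "coboundary n X (cochain_pullback n X f c) \<sigma> = cochain_pullback (Suc n) X f (coboundary n Y c) \<sigma>"
    using singular_simplex_singular_face[of "Suc n" X \<sigma>] singular_simplex_simplex_map[OF _ assms, of "Suc n" \<sigma>]
    by (auto simp: coboundary_def cochain_pullback_def simp del: sum.atMost_Suc intro!: sum.cong)
qed

theorem coh_induced_coh_class:
  assumes f: "continuous_map X Y f"
  shows "coh_induced X f (\<lambda>n. coh_class n Y (c n)) n = coh_class n X (cochain_pullback n X f (c n))"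
proof -
  have cb: "cochain_pullback n X f b \<in> coboundaries n X" if b: "b \<in> coboundaries n Y" for b
  proof (cases n)
    case 0
    then show ?thesis using b by (auto simp: coboundaries_def cochain_pullback_def)
  next
    case (Suc m)
    then obtain e where "e \<in> cochains m Y" "b = coboundary m Y e"
      using b by (auto simp: coboundaries_def)
    moreover have "cochain_pullback m X f e \<in> cochains m X"
      by (simp add: cochains_def cochain_pullback_def)
    ultimately show ?thesis
      unfolding coboundaries_def Suc by (auto simp flip: coboundary_cochain_pullback[OF f])
  qed
  have add: "cochain_pullback n X f (\<lambda>\<sigma>. c n \<sigma> + b \<sigma>) =
        (\<lambda>\<sigma>. cochain_pullback n X f (c n) \<sigma> + cochain_pullback n X f b \<sigma>)" for b
    by (auto simp: cochain_pullback_def)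
  have "coh_class n X (cochain_pullback n X f c') = coh_class n X (cochain_pullback n X f (c n))"
    if "c' \<in> coh_class n Y (c n)" for c'
  proof -
    obtain b where "b \<in> coboundaries n Y" "c' = (\<lambda>\<sigma>. c n \<sigma> + b \<sigma>)"
      using \<open>c' \<in> coh_class n Y (c n)\<close> by (auto simp: coh_class_def)
    then show ?thesis using coh_class_cong[OF cb] by (simp add: add)
  qed
  moreover have "c n \<in> coh_class n Y (c n)"
    unfolding coh_class_def using zero_in_coboundaries by force
  ultimately show ?thesis unfolding coh_induced_def by blast
qed

section \<open>The orbit space of the fibre product and the image of the diagonal\<close>

definition orbit_fibre_product :: "('g \<Rightarrow> 'e \<Rightarrow> 'e) \<Rightarrow> 'e topology \<Rightarrow> ('e \<Rightarrow> 'b) \<Rightarrow> ('e \<times> 'e) set topology" where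
  "orbit_fibre_product \<alpha> E p = orbit_space (prod_act \<alpha> \<alpha>) (fibre_product E p)"

definition orbit_diagonal :: "('g \<Rightarrow> 'e \<Rightarrow> 'e) \<Rightarrow> 'e topology \<Rightarrow> ('e \<times> 'e) set set" where
  "orbit_diagonal \<alpha> E = orbit_of (prod_act \<alpha> \<alpha>) ` (\<lambda>e. (e, e)) ` topspace E"

end

theory Submission
  imports Defs
begin

text \<open>
  The proof is an equivariant form of the Lusternik-Schnirelmann cup length argument, carried out in the orbit
  space \<open>Q = (E \<times>\<^sub>B E)/G\<close>.  Suppose that \<open>E \<times>\<^sub>B E\<close> is covered by at most \<open>k\<close> invariant open sets \<open>U\<^sub>i\<close> with
  equivariant sections, up to homotopy, of the path fibration.  Shrinking the paths given by a section deforms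
  \<open>U\<^sub>i\<close> equivariantly into the diagonal inside \<open>E \<times>\<^sub>B E\<close> (\<open>section_contracts_to_diagonal\<close>).  The orbit map is open, so its
  product with the interval is still a quotient map over \<open>U\<^sub>i\<close>, and the deformation descends to a deformation of the open
  set \<open>U\<^sub>i/G\<close> into the image of the diagonal, inside \<open>Q\<close> (\<open>orbit_space_homotopic\<close>).  By homotopy invariance
  each \<open>u\<^sub>i\<close> restricts to zero on \<open>U\<^sub>i/G\<close>; it is therefore represented by a cocycle that vanishes on the singular simplices
  of \<open>U\<^sub>i/G\<close> (\<open>relative_representative\<close>).  The cup product of these cocycles vanishes on all simplices that lie in
  one of the sets \<open>U\<^sub>i/G\<close>.  Since these sets are open and cover \<open>Q\<close>, a cocycle with this property is a coboundary
  (\<open>cocycle_vanishing_on_small_simplices\<close>), which contradicts \<open>u\<^sub>1 \<cdots> u\<^sub>k \<noteq> 0\<close>.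

  The coefficient ring is arbitrary, so vanishing of homology groups does not transfer to cohomology directly.  Homotopy
  invariance and the small simplices theorem are therefore proved from chain homotopies, which are
  constructed by recursion on the degree from the freeness of the chain groups and an acyclicity statement: the
  contractibility of \<open>[0,1] \<times> \<Delta>\<^sup>q\<close> in the first case (\<open>prism_model\<close>), barycentric subdivision in the second
  (\<open>small_homotopy\<close>).
\<close>

section \<open>Evaluation of cochains on chains\<close>

definition cochain_eval :: "('a, 'r::comm_ring_1) cochain \<Rightarrow> 'a chain \<Rightarrow> 'r" where
  "cochain_eval c z = (\<Sum>\<sigma>\<in>Poly_Mapping.keys z. of_int (Poly_Mapping.lookup z \<sigma>) * c \<sigma>)"

lemma cochain_eval_superset:
  assumes "finite S" "Poly_Mapping.keys z \<subseteq> S"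
  shows "cochain_eval c z = (\<Sum>\<sigma>\<in>S. of_int (Poly_Mapping.lookup z \<sigma>) * c \<sigma>)"
  unfolding cochain_eval_def
  by (rule sum.mono_neutral_left) (use assms in \<open>auto simp: in_keys_iff\<close>)

lemma cochain_eval_0 [simp]: "cochain_eval c 0 = 0"
  by (simp add: cochain_eval_def)

lemma cochain_eval_of [simp]: "cochain_eval c (frag_of \<sigma>) = c \<sigma>"
  by (simp add: cochain_eval_def)

lemma cochain_eval_add: "cochain_eval c (y + z) = cochain_eval c y + cochain_eval c z"
proof -
  let ?S = "Poly_Mapping.keys y \<union> Poly_Mapping.keys z"
  have "Poly_Mapping.keys (y + z) \<subseteq> ?S" by (rule keys_add)
  then show ?thesis
    by (simp add: cochain_eval_superset[of ?S] lookup_add distrib_right sum.distrib)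
qed

lemma cochain_eval_cmul: "cochain_eval c (frag_cmul a z) = of_int a * cochain_eval c z"
  using keys_cmul[of a z]
  by (simp add: cochain_eval_superset[of "Poly_Mapping.keys z"] sum_distrib_left mult.assoc)

lemma cochain_eval_diff: "cochain_eval c (y - z) = cochain_eval c y - cochain_eval c z"
  using cochain_eval_add[of c y "frag_cmul (-1) z"] cochain_eval_cmul[of c "-1" z] by simp

lemma cochain_eval_sum: "cochain_eval c (\<Sum>i\<in>I. f i) = (\<Sum>i\<in>I. cochain_eval c (f i))"
  by (induction I rule: infinite_finite_induct) (auto simp: cochain_eval_add)

lemma cochain_eval_eq_0:
  "(\<And>\<sigma>. \<sigma> \<in> Poly_Mapping.keys z \<Longrightarrow> c \<sigma> = 0) \<Longrightarrow> cochain_eval c z = 0"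
  by (simp add: cochain_eval_def)

lemma cochain_eval_chain_boundary:
  assumes "singular_chain (Suc n) X z"
  shows "cochain_eval c (chain_boundary (Suc n) z) = cochain_eval (coboundary n X c) z"
  using assms unfolding singular_chain_def
proof (induction z rule: frag_induction)
  case (one \<sigma>)
  then show ?case
    by (simp add: chain_boundary_of cochain_eval_sum cochain_eval_cmul coboundary_def del: sum.atMost_Suc)
qed (auto simp: chain_boundary_diff cochain_eval_diff)

text \<open>
  Both homological inputs of the proof are chain homotopies, used only after pairing with a cocycle:
  pairing with \<open>c\<close> kills \<open>\<partial>D\<close>, so that the cochain \<open>\<langle>c, \<partial>D + D\<partial>\<rangle>\<close> is the coboundary of \<open>\<langle>c, D\<rangle>\<close>.  In
  this form the argument also applies to a chain homotopy modulo chains on which \<open>c\<close> vanishes.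
\<close>

lemma coboundaries_of_chain_homotopy:
  assumes d: "\<And>\<sigma>. singular_simplex n X \<sigma> \<Longrightarrow> singular_chain (Suc n) Y (d n \<sigma>)"
    and c: "c \<in> cocycles n Y" and b: "b \<in> cochains n X"
    and eq: "\<And>\<sigma>. singular_simplex n X \<sigma> \<Longrightarrow>
      b \<sigma> = cochain_eval c (chain_boundary (Suc n) (d n \<sigma>) +
                            frag_extend (d (n - 1)) (chain_boundary n (frag_of \<sigma>)))"
  shows "b \<in> coboundaries n X"
proof -
  have bnd: "b \<sigma> = cochain_eval c (frag_extend (d (n - 1)) (chain_boundary n (frag_of \<sigma>)))"
    if "singular_simplex n X \<sigma>" for \<sigma>
  proof -
    have "cochain_eval c (chain_boundary (Suc n) (d n \<sigma>)) = 0"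
      using c by (simp add: cochain_eval_chain_boundary[OF d[OF that]] cocycles_def cochain_eval_eq_0)
    then show ?thesis using eq[OF that] by (simp add: cochain_eval_add)
  qed
  show ?thesis
  proof (cases n)
    case 0
    \<comment> \<open>The boundary of a \<open>0\<close>-simplex is zero, hence \<open>b\<close> itself vanishes, as coboundaries of degree \<open>0\<close> must.\<close>
    have "b \<sigma> = 0" for \<sigma>
      using bnd[of \<sigma>] b by (cases "singular_simplex n X \<sigma>") (auto simp: 0 chain_boundary_def cochains_def)
    then show ?thesis by (auto simp: coboundaries_def 0)
  next
    case (Suc m)
    define e where "e = (\<lambda>\<tau>. if singular_simplex m X \<tau> then cochain_eval c (d m \<tau>) else 0)"
    have "b \<sigma> = coboundary m X e \<sigma>" for \<sigma>
    proof (cases "singular_simplex n X \<sigma>")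
      case True
      then have "singular_simplex m X (singular_face (Suc m) k \<sigma>)" if "k \<le> Suc m" for k
        using singular_simplex_singular_face[of "Suc m" X \<sigma> k] that by (simp add: Suc)
      then show ?thesis
        using bnd[OF True] True
        by (simp add: Suc chain_boundary_of frag_extend_sum frag_extend_cmul cochain_eval_sum
            cochain_eval_cmul coboundary_def e_def del: sum.atMost_Suc)
    next
      case False
      then show ?thesis using b by (simp add: Suc coboundary_def cochains_def)
    qed
    then have "b = coboundary m X e" by blast
    moreover have "e \<in> cochains m X" by (simp add: e_def cochains_def)
    ultimately show ?thesis by (simp add: coboundaries_def Suc)
  qed
qed

section \<open>Homotopy invariance of singular cohomology\<close>

abbreviation simplex_space :: "nat \<Rightarrow> (nat \<Rightarrow> real) topology" where
  "simplex_space q \<equiv> subtopology (powertop_real UNIV) (standard_simplex q)"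

abbreviation identity_simplex :: "nat \<Rightarrow> (nat \<Rightarrow> real) \<Rightarrow> nat \<Rightarrow> real" where
  "identity_simplex q \<equiv> restrict id (standard_simplex q)"

lemma singular_identity_simplex: "singular_simplex q (simplex_space q) (identity_simplex q)"
proof -
  have "continuous_map (simplex_space q) (simplex_space q) (identity_simplex q)"
    by (rule continuous_map_eq[OF continuous_map_id]) auto
  then show ?thesis by (simp add: singular_simplex_def)
qed

lemma simplex_map_identity_simplex:
  assumes "singular_simplex q X \<sigma>"
  shows "simplex_map q \<sigma> (identity_simplex q) = \<sigma>"
  using assms extensional_arb by (fastforce simp: simplex_map_def singular_simplex_def)

text \<open>
  The cylinder over a simplex is convex, hence its positive-dimensional cycles bound.  A \<open>0\<close>-cycle bounds
  if its coefficients sum to \<open>0\<close>, which is expressed by its image under constant maps.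
\<close>

lemma null_homologous_in_cylinder:
  assumes z: "singular_chain q (cylinder (simplex_space q)) z" "chain_boundary q z = 0"
    and q: "q = 0 \<longrightarrow> (\<forall>a::real \<times> (nat \<Rightarrow> real). chain_map 0 (\<lambda>_. a) z = 0)"
  shows "\<exists>w. singular_chain (Suc q) (cylinder (simplex_space q)) w \<and> chain_boundary (Suc q) w = z"
proof -
  let ?X = "cylinder (simplex_space q)"
  define v :: "nat \<Rightarrow> real" where "v = (\<lambda>i. if i = 0 then 1 else 0)"
  have v: "v \<in> standard_simplex q" by (simp add: v_def)
  \<comment> \<open>The straight-line contraction to the point \<open>(0, v)\<close> over a vertex \<open>v\<close>.\<close>
  let ?k = "\<lambda>w::real \<times> real \<times> (nat \<Rightarrow> real).
    ((1 - fst w) * fst (snd w), \<lambda>i. (1 - fst w) * snd (snd w) i + fst w * v i)"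
  have s: "continuous_map (cylinder ?X) euclideanreal fst"
    using continuous_map_fst continuous_map_into_fulltopology by blast
  have t: "continuous_map (cylinder ?X) euclideanreal (\<lambda>w. fst (snd w))"
    using continuous_map_fst_snd continuous_map_into_fulltopology by blast
  have "continuous_map (cylinder ?X) (powertop_real UNIV) (\<lambda>w. snd (snd w))"
    using continuous_map_snd_snd continuous_map_into_fulltopology by blast
  then have x: "continuous_map (cylinder ?X) euclideanreal (\<lambda>w. snd (snd w) i)" for i
    by (simp add: continuous_map_componentwise_UNIV)
  have "continuous_map (cylinder ?X) unit_interval (\<lambda>w. fst (?k w))"
    using s t by (auto simp: continuous_map_in_subtopology mult_le_one
        intro!: continuous_map_real_mult continuous_map_diff)
  moreover have "continuous_map (cylinder ?X) (simplex_space q) (\<lambda>w. snd (?k w))"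
    unfolding continuous_map_in_subtopology continuous_map_componentwise_UNIV
  proof (intro conjI allI)
    show "continuous_map (cylinder ?X) euclideanreal (\<lambda>w. snd (?k w) i)" for i
      using s x[of i] by (simp add: continuous_map_real_mult continuous_map_diff continuous_map_add)
    show "(\<lambda>w. snd (?k w)) \<in> topspace (cylinder ?X) \<rightarrow> standard_simplex q"
      using convex_standard_simplex[OF _ v] by auto
  qed
  ultimately have k: "continuous_map (cylinder ?X) ?X ?k"
    by (simp add: continuous_map_pairedI)
  have "homotopic_with (\<lambda>h. h \<in> {} \<rightarrow> {}) ?X ?X id (\<lambda>_. (0, v))"
    unfolding homotopic_with_def by (rule exI[of _ ?k]) (use k in auto)
  moreover have "singular_relcycle q ?X {} z" using z by (simp add: singular_cycle)
  ultimately have "homologous_rel q ?X {} (chain_map q id z) (chain_map q (\<lambda>_. (0, v)) z)"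
    by (rule homotopic_imp_homologous_rel_chain_maps)
  moreover have "chain_map q id z = z" using z(1) by (rule chain_map_ident)
  moreover have "singular_relboundary q ?X {} (chain_map q (\<lambda>_. (0, v)) z)"
  proof (cases "q = 0")
    case True
    then show ?thesis using q by simp
  next
    case False
    \<comment> \<open>After the contraction the cycle lives in a one-point space, where positive-dimensional cycles bound.\<close>
    let ?Y = "subtopology ?X {(0, v)}"
    have Y: "topspace ?Y = {(0, v)}" using v by auto
    have "continuous_map ?X ?Y (\<lambda>_. (0, v))"
      using v by (auto simp: continuous_map_in_subtopology)
    then have "singular_relcycle q ?Y {} (chain_map q (\<lambda>_. (0, v)) z)"
      using z by (simp add: singular_cycle singular_chain_chain_map chain_boundary_chain_map)
    then have "singular_relboundary q ?Y {} (chain_map q (\<lambda>_. (0, v)) z)"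
      using False by (subst singular_boundary_eq_cycle_singleton[OF Y]) auto
    then show ?thesis unfolding singular_boundary singular_chain_subtopology by blast
  qed
  ultimately have "singular_relboundary q ?X {} (z - chain_map q (\<lambda>_. (0, v)) z + chain_map q (\<lambda>_. (0, v)) z)"
    by (intro singular_relboundary_add) (auto simp: homologous_rel_def)
  then show ?thesis by (simp add: singular_boundary)
qed

lemma chain_map_chain_map: "chain_map q f (chain_map q g c) = chain_map q (f \<circ> g) c"
  by (simp add: chain_map_compose)

definition cylinder_ends :: "nat \<Rightarrow> 'a chain \<Rightarrow> (real \<times> 'a) chain" where
  "cylinder_ends q c = chain_map q (Pair 1) c - chain_map q (Pair 0) c"

text \<open>
  The prism operator by acyclic models.  On the identity simplex it must be a chain in
  \<open>[0,1] \<times> \<Delta>\<^sup>q\<close> whose boundary is the difference of the two ends minus the prisms over the faces; on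
  an arbitrary simplex \<open>\<sigma>\<close> it is then the image of that chain under \<open>id \<times> \<sigma>\<close>.  Any chain with this boundary
  serves, and it exists because the prescribed boundary is a cycle in a contractible space
  (in degree \<open>0\<close>, a difference of two points).
\<close>

definition next_prism :: "nat \<Rightarrow> (real \<times> (nat \<Rightarrow> real)) chain \<Rightarrow> (real \<times> (nat \<Rightarrow> real)) chain" where
  "next_prism q w = (SOME w'. singular_chain (Suc q) (cylinder (simplex_space q)) w' \<and>
     chain_boundary (Suc q) w' = cylinder_ends q (frag_of (identity_simplex q)) -
       frag_extend (\<lambda>\<tau>. chain_map q (map_prod id \<tau>) w) (chain_boundary q (frag_of (identity_simplex q))))"

primrec prism_model :: "nat \<Rightarrow> (real \<times> (nat \<Rightarrow> real)) chain" where
  "prism_model 0 = next_prism 0 0"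
| "prism_model (Suc q) = next_prism (Suc q) (prism_model q)"

text \<open>
  In degree \<open>0\<close> the faces contribute nothing, so the model chain one degree below may be taken
  to be anything; with \<open>0 - 1 = 0\<close> both recursion equations take one form.
\<close>

lemma prism_model_eq: "prism_model q = next_prism q (prism_model (q - 1))"
  by (cases q) (simp_all add: next_prism_def chain_boundary_def)

definition prism :: "nat \<Rightarrow> ((nat \<Rightarrow> real) \<Rightarrow> 'a) \<Rightarrow> (real \<times> 'a) chain" where
  "prism q \<sigma> = chain_map (Suc q) (map_prod id \<sigma>) (prism_model q)"

lemma continuous_map_prod_simplex:
  "singular_simplex q X \<sigma> \<Longrightarrow>
     continuous_map (cylinder (simplex_space q)) (cylinder X) (map_prod id \<sigma>)"
  unfolding singular_simplex_def map_prod_def case_prod_unfold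
  by (intro continuous_map_pairedI)
     (auto simp: id_def intro: continuous_map_fst continuous_map_compose[OF continuous_map_snd, unfolded o_def])

lemma continuous_map_Pair_const: "t \<in> {0..1} \<Longrightarrow> continuous_map X (cylinder X) (Pair t)"
  by (auto intro!: continuous_map_pairedI)

lemma cylinder_ends_0 [simp]: "cylinder_ends q 0 = 0"
  by (simp add: cylinder_ends_def)

lemma cylinder_ends_diff: "cylinder_ends q (a - b) = cylinder_ends q a - cylinder_ends q b"
  by (simp add: cylinder_ends_def chain_map_diff)

lemma singular_chain_cylinder_ends: "singular_chain q X c \<Longrightarrow> singular_chain q (cylinder X) (cylinder_ends q c)"
  unfolding cylinder_ends_def
  by (intro singular_chain_diff singular_chain_chain_map[where X = X] continuous_map_Pair_const) auto

lemma chain_boundary_cylinder_ends: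
  "singular_chain q X c \<Longrightarrow> chain_boundary q (cylinder_ends q c) = cylinder_ends (q - 1) (chain_boundary q c)"
  by (simp add: cylinder_ends_def chain_boundary_diff chain_boundary_chain_map)

lemma cylinder_ends_natural: "chain_map q (map_prod id f) (cylinder_ends q c) = cylinder_ends q (chain_map q f c)"
proof -
  have "map_prod id f \<circ> Pair t = Pair t \<circ> f" for t :: real by auto
  then show ?thesis by (simp only: cylinder_ends_def chain_map_diff chain_map_chain_map)
qed

definition has_prism_boundary :: "nat \<Rightarrow> bool" where
  "has_prism_boundary q \<longleftrightarrow> singular_chain (Suc q) (cylinder (simplex_space q)) (prism_model q) \<and>
     chain_boundary (Suc q) (prism_model q) = cylinder_ends q (frag_of (identity_simplex q)) -
       frag_extend (prism (q - 1)) (chain_boundary q (frag_of (identity_simplex q)))"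

lemma singular_chain_prism:
  assumes "singular_chain (Suc q) (cylinder (simplex_space q)) (prism_model q)"
    and "singular_chain q X c"
  shows "singular_chain (Suc q) (cylinder X) (frag_extend (prism q) c)"
  using assms(2) unfolding prism_def singular_chain_def[of q]
  by (intro singular_chain_extend singular_chain_chain_map[OF assms(1)] continuous_map_prod_simplex) auto

text \<open>
  Naturality turns the boundary formula of the model into that of every simplex.
\<close>

lemma prism_natural:
  assumes model: "singular_chain (Suc q) (cylinder (simplex_space q)) (prism_model q)"
    and c: "singular_chain q X c"
  shows "chain_map (Suc q) (map_prod id f) (frag_extend (prism q) c) =
         frag_extend (prism q) (chain_map q f c)"
  using c unfolding singular_chain_def
proof (induction c rule: frag_induction)
  case (one \<tau>)
  have "chain_map (Suc q) (map_prod id f) (prism q \<tau>) =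
        chain_map (Suc q) (map_prod id f \<circ> map_prod id \<tau>) (prism_model q)"
    by (simp add: prism_def chain_map_compose)
  also have "\<dots> = prism q (simplex_map q f \<tau>)"
    unfolding prism_def by (rule chain_map_eq[OF model]) (auto simp: simplex_map_def)
  finally show ?case by (simp only: chain_map_of frag_extend_of)
qed (simp_all only: chain_map_diff frag_extend_diff chain_map_0 frag_extend_0)

text \<open>
  This is stated for one degree at a time, because the formula in degree \<open>q\<close>, applied to the boundary of
  the identity simplex, shows that the boundary prescribed in degree \<open>q + 1\<close> is a cycle.
\<close>

lemma chain_boundary_prism_aux:
  assumes ok: "has_prism_boundary q" and model: "q > 0 \<longrightarrow> has_prism_boundary (q - 1)" and c: "singular_chain q X c"
  shows "chain_boundary (Suc q) (frag_extend (prism q) c) +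
         frag_extend (prism (q - 1)) (chain_boundary q c) = cylinder_ends q c"
  using c unfolding singular_chain_def
proof (induction c rule: frag_induction)
  case (one \<sigma>)
  then have s: "singular_simplex q X \<sigma>" by simp
  let ?I = "frag_of (identity_simplex q)"
  have I: "singular_chain q (simplex_space q) ?I"
    by (simp only: singular_chain_of singular_identity_simplex)
  have sI: "chain_map q \<sigma> ?I = frag_of \<sigma>"
    using simplex_map_identity_simplex[OF s] by simp
  have "chain_boundary (Suc q) (frag_extend (prism q) (frag_of \<sigma>)) =
        chain_map q (map_prod id \<sigma>) (chain_boundary (Suc q) (prism_model q))"
    using chain_boundary_chain_map[of "Suc q" "cylinder (simplex_space q)" "prism_model q" "map_prod id \<sigma>"] ok
    by (simp add: prism_def has_prism_boundary_def)
  also have "\<dots> = cylinder_ends q (frag_of \<sigma>) -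
      chain_map q (map_prod id \<sigma>) (frag_extend (prism (q - 1)) (chain_boundary q ?I))"
    using ok by (simp only: has_prism_boundary_def chain_map_diff cylinder_ends_natural sI)
  also have "chain_map q (map_prod id \<sigma>) (frag_extend (prism (q - 1)) (chain_boundary q ?I)) =
      frag_extend (prism (q - 1)) (chain_boundary q (frag_of \<sigma>))"
  proof (cases q)
    case (Suc r)
    have "singular_chain r (simplex_space q) (chain_boundary q ?I)"
      using singular_chain_boundary_alt I Suc by blast
    from prism_natural[OF _ this, of \<sigma>] show ?thesis
      using model chain_boundary_chain_map[OF I, of \<sigma>] unfolding sI by (simp add: has_prism_boundary_def Suc)
  qed (simp add: chain_boundary_def)
  finally show ?case by simp
qed (auto simp: chain_boundary_diff frag_extend_diff cylinder_ends_diff algebra_simps)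

lemma prism_model_boundary: "has_prism_boundary q"
proof (induction q rule: less_induct)
  case (less q)
  let ?I = "frag_of (identity_simplex q)"
  let ?z = "cylinder_ends q ?I - frag_extend (prism (q - 1)) (chain_boundary q ?I)"
  have I: "singular_chain q (simplex_space q) ?I"
    by (simp only: singular_chain_of singular_identity_simplex)
  have "singular_chain q (cylinder (simplex_space q)) ?z \<and> chain_boundary q ?z = 0 \<and>
      (q = 0 \<longrightarrow> (\<forall>a::real \<times> (nat \<Rightarrow> real). chain_map 0 (\<lambda>_. a) ?z = 0))"
  proof (cases q)
    case 0
    have "chain_map 0 (\<lambda>_. a) (cylinder_ends 0 c) = 0" for a :: "real \<times> (nat \<Rightarrow> real)" and c :: "(nat \<Rightarrow> real) chain"
      by (simp add: cylinder_ends_def chain_map_diff chain_map_chain_map o_def)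
    then show ?thesis using singular_chain_cylinder_ends[OF I]
      by (simp add: 0 chain_boundary_def)
  next
    case (Suc r)
    have dI: "singular_chain r (simplex_space q) (chain_boundary q ?I)"
      using singular_chain_boundary_alt I Suc by blast
    have ok: "has_prism_boundary r" "r > 0 \<longrightarrow> has_prism_boundary (r - 1)" using less Suc by auto
    then have "singular_chain q (cylinder (simplex_space q)) (frag_extend (prism r) (chain_boundary q ?I))"
      using singular_chain_prism[OF _ dI] Suc by (simp add: has_prism_boundary_def)
    moreover have "chain_boundary r (chain_boundary q ?I) = 0"
      using chain_boundary_boundary_alt I Suc by blast
    then have "chain_boundary q (frag_extend (prism r) (chain_boundary q ?I)) = cylinder_ends r (chain_boundary q ?I)"
      using chain_boundary_prism_aux[OF ok dI] Suc by simp
    ultimately show ?thesis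
      using singular_chain_cylinder_ends[OF I] chain_boundary_cylinder_ends[OF I]
      by (simp add: Suc singular_chain_diff chain_boundary_diff)
  qed
  then have ex: "\<exists>w. singular_chain (Suc q) (cylinder (simplex_space q)) w \<and> chain_boundary (Suc q) w = ?z"
    by (intro null_homologous_in_cylinder) auto
  have eq: "frag_extend (prism (q - 1)) (chain_boundary q ?I) =
      frag_extend (\<lambda>\<tau>. chain_map q (map_prod id \<tau>) (prism_model (q - 1))) (chain_boundary q ?I)"
  proof (cases q)
    case (Suc r)
    show ?thesis by (simp only: Suc prism_def[abs_def] diff_Suc_1)
  qed (simp add: chain_boundary_def)
  show ?case
    using someI_ex[OF ex] unfolding has_prism_boundary_def prism_model_eq[of q] next_prism_def eq .
qed

lemma chain_boundary_prism:
  assumes "singular_chain q X c"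
  shows "chain_boundary (Suc q) (frag_extend (prism q) c) +
         frag_extend (prism (q - 1)) (chain_boundary q c) = cylinder_ends q c"
  using chain_boundary_prism_aux prism_model_boundary assms by blast

text \<open>
  Homotopy invariance of cohomology: a homotopy is a map on the cylinder, and it carries the prism
  operator to a chain homotopy between the induced chain maps.
\<close>

lemma homotopic_imp_pullback_cohomologous:
  assumes hom: "homotopic_with (\<lambda>_. True) X Y f g" and c: "c \<in> cocycles n Y"
  shows "(\<lambda>\<sigma>. cochain_pullback n X g c \<sigma> - cochain_pullback n X f c \<sigma>) \<in> coboundaries n X"
proof -
  obtain h where h: "continuous_map (cylinder X) Y h" "\<And>x. h (0, x) = f x" "\<And>x. h (1, x) = g x"
    using hom by (auto simp: homotopic_with_def)
  have hf: "chain_map q h (cylinder_ends q c) = chain_map q g c - chain_map q f c" for q c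
  proof -
    have "h \<circ> Pair 0 = f" "h \<circ> Pair 1 = g" using h by auto
    then show ?thesis by (simp only: cylinder_ends_def chain_map_diff chain_map_chain_map)
  qed
  let ?d = "\<lambda>q \<sigma>. chain_map (Suc q) h (prism q \<sigma>)"
  have D: "frag_extend (?d q) c = chain_map (Suc q) h (frag_extend (prism q) c)" for q c
    using subset_UNIV[of "Poly_Mapping.keys c"]
    by (induction c rule: frag_induction) (auto simp: frag_extend_diff chain_map_diff)
  have P: "singular_chain (Suc n) (cylinder X) (prism n \<sigma>)" if "singular_simplex n X \<sigma>" for \<sigma> n
    using singular_chain_prism[of n X "frag_of \<sigma>"] prism_model_boundary that
    by (simp add: has_prism_boundary_def singular_chain_of)
  show ?thesis
  proof (rule coboundaries_of_chain_homotopy[where d = ?d, OF _ c])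
    show "singular_chain (Suc n) Y (?d n \<sigma>)" if "singular_simplex n X \<sigma>" for \<sigma>
      using P[OF that] h(1) by (rule singular_chain_chain_map)
    show "(\<lambda>\<sigma>. cochain_pullback n X g c \<sigma> - cochain_pullback n X f c \<sigma>) \<in> cochains n X"
      by (simp add: cochains_def cochain_pullback_def)
    fix \<sigma> assume s: "singular_simplex n X \<sigma>"
    then have "singular_chain n X (frag_of \<sigma>)" by (simp add: singular_chain_of)
    note b = chain_boundary_prism[OF this]
    have "chain_boundary (Suc n) (?d n \<sigma>) + frag_extend (?d (n - 1)) (chain_boundary n (frag_of \<sigma>))
        = chain_map n h (chain_boundary (Suc n) (prism n \<sigma>)) +
          chain_map n h (frag_extend (prism (n - 1)) (chain_boundary n (frag_of \<sigma>)))"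
      using chain_boundary_chain_map[OF P[OF s], of h]
      by (cases n) (simp_all add: D chain_boundary_def)
    also have "\<dots> = chain_map n h (cylinder_ends n (frag_of \<sigma>))"
      using b by (simp flip: chain_map_add)
    also have "\<dots> = frag_of (simplex_map n g \<sigma>) - frag_of (simplex_map n f \<sigma>)"
      by (simp add: hf)
    finally show "cochain_pullback n X g c \<sigma> - cochain_pullback n X f c \<sigma> =
        cochain_eval c (chain_boundary (Suc n) (?d n \<sigma>) +
          frag_extend (?d (n - 1)) (chain_boundary n (frag_of \<sigma>)))"
      using s by (simp add: cochain_eval_diff cochain_pullback_def)
  qed
qed

section \<open>Cocycles that vanish on small simplices\<close>

definition small_chain :: "nat \<Rightarrow> 'a topology \<Rightarrow> 'a set set \<Rightarrow> 'a chain \<Rightarrow> bool" where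
  "small_chain n X \<C> z \<longleftrightarrow>
     (\<forall>\<sigma>\<in>Poly_Mapping.keys z. \<exists>V\<in>\<C>. singular_simplex n (subtopology X V) \<sigma>)"

lemma small_chain_0 [simp]: "small_chain n X \<C> 0"
  by (simp add: small_chain_def)

lemma small_chain_diff: "small_chain n X \<C> a \<Longrightarrow> small_chain n X \<C> b \<Longrightarrow> small_chain n X \<C> (a - b)"
  using keys_diff[of a b] by (auto simp: small_chain_def)

lemma small_chainI: "V \<in> \<C> \<Longrightarrow> singular_chain n (subtopology X V) z \<Longrightarrow> small_chain n X \<C> z"
  unfolding small_chain_def singular_chain_def by blast

text \<open>
  An operator that is compatible with subspaces, such as one given by a natural construction, preserves
  smallness.
\<close>

lemma small_chain_operator:
  assumes h: "h 0 = 0" "\<And>a b. h (a - b) = h a - h b"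
    and sub: "\<And>V \<sigma>. singular_simplex m (subtopology X V) \<sigma> \<Longrightarrow> singular_chain n (subtopology X V) (h (frag_of \<sigma>))"
    and z: "small_chain m X \<C> z"
  shows "small_chain n X \<C> (h z)"
proof -
  have "Poly_Mapping.keys z \<subseteq> {\<sigma>. \<exists>V\<in>\<C>. singular_simplex m (subtopology X V) \<sigma>}"
    using z by (auto simp: small_chain_def)
  then show ?thesis
    by (induction z rule: frag_induction) (auto simp: h small_chain_diff intro: small_chainI sub)
qed

text \<open>
  The complex of chains modulo small chains is acyclic: sufficiently iterated barycentric
  subdivision makes a chain small, it is chain homotopic to the identity, and the homotopy, being natural,
  keeps the small boundary of \<open>z\<close> small.
\<close>

lemma small_mod_boundary:
  assumes \<C>: "\<And>V. V \<in> \<C> \<Longrightarrow> openin X V" "topspace X \<subseteq> \<Union>\<C>"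
    and z: "singular_chain n X z" and dz: "small_chain (n - 1) X \<C> (chain_boundary n z)"
  shows "\<exists>w. singular_chain (Suc n) X w \<and> small_chain n X \<C> (z - chain_boundary (Suc n) w)"
proof -
  obtain N where N: "\<And>f. f \<in> Poly_Mapping.keys ((singular_subdivision n ^^ N) z) \<Longrightarrow>
      \<exists>V\<in>\<C>. f \<in> standard_simplex n \<rightarrow> V"
    using sufficient_iterated_singular_subdivision_exists[OF \<C> z] by (metis order_refl)
  obtain h where h: "\<And>p. h p 0 = (0 :: 'a chain)" "\<And>p a b. h p (a - b) = h p a - h p b"
    "\<And>p X c. singular_chain p X c \<Longrightarrow> singular_chain (Suc p) X (h p c)"
    "\<And>p X c. singular_chain p X c \<Longrightarrow> chain_boundary (Suc p) (h p c) +
        h (p - Suc 0) (chain_boundary p c) = (singular_subdivision p ^^ N) c - c"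
    by (rule chain_homotopic_iterated_singular_subdivision[where n = N]) (rule that; assumption)
  have "singular_chain n X ((singular_subdivision n ^^ N) z)"
    by (induction N) (auto simp: z singular_chain_singular_subdivision)
  then have Sd: "small_chain n X \<C> ((singular_subdivision n ^^ N) z)"
    unfolding small_chain_def singular_simplex_subtopology singular_chain_def
    using N by (metis image_subset_iff_funcset mem_Collect_eq subset_eq)
  have hz: "small_chain n X \<C> (h (n - 1) (chain_boundary n z))"
  proof (cases n)
    case (Suc m)
    then show ?thesis
      using small_chain_operator[of "h m" m X n \<C> "chain_boundary n z"] h dz
      by (simp add: singular_chain_of)
  qed (simp add: chain_boundary_def h)
  have "z - chain_boundary (Suc n) (- h n z) =
      (singular_subdivision n ^^ N) z - h (n - 1) (chain_boundary n z)"
    using h(4)[OF z] by (simp add: chain_boundary_minus algebra_simps)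
  then show ?thesis
    using small_chain_diff[OF Sd hz] h(3)[OF z] by (intro exI[of _ "- h n z"]) (simp add: singular_chain_minus)
qed

text \<open>
  A contraction of the complex of chains modulo small chains.  Acyclicity alone does not suffice for cohomology with
  arbitrary coefficients, but the complex is free, and so a contraction can be chosen simplex by
  simplex, by recursion on the degree.  The number of subdivisions may depend on the simplex.  A
  \<open>0\<close>-simplex is a point, hence already small.
\<close>

primrec small_homotopy :: "'a topology \<Rightarrow> 'a set set \<Rightarrow> nat \<Rightarrow> ((nat \<Rightarrow> real) \<Rightarrow> 'a) \<Rightarrow> 'a chain" where
  "small_homotopy X \<C> 0 = (\<lambda>\<sigma>. 0)"
| "small_homotopy X \<C> (Suc n) = (\<lambda>\<sigma>. SOME w. singular_chain (Suc (Suc n)) X w \<and>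
     small_chain (Suc n) X \<C>
       (frag_of \<sigma> - frag_extend (small_homotopy X \<C> n) (chain_boundary (Suc n) (frag_of \<sigma>))
        - chain_boundary (Suc (Suc n)) w))"

lemma small_homotopy:
  assumes \<C>: "\<And>V. V \<in> \<C> \<Longrightarrow> openin X V" "topspace X \<subseteq> \<Union>\<C>" and \<sigma>: "singular_simplex n X \<sigma>"
  shows "singular_chain (Suc n) X (small_homotopy X \<C> n \<sigma>) \<and>
    small_chain n X \<C> (frag_of \<sigma> - frag_extend (small_homotopy X \<C> (n - 1)) (chain_boundary n (frag_of \<sigma>))
      - chain_boundary (Suc n) (small_homotopy X \<C> n \<sigma>))"
  using \<sigma>
proof (induction n arbitrary: \<sigma>)
  case 0
  have "\<sigma> ` standard_simplex 0 \<subseteq> topspace X"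
    using 0 by (auto simp: singular_simplex_def continuous_map_def)
  then obtain V where "V \<in> \<C>" "\<sigma> ` standard_simplex 0 \<subseteq> V"
    using \<C>(2) by (auto simp: standard_simplex_0)
  then show ?case
    using 0 by (auto simp: chain_boundary_def singular_simplex_subtopology small_chain_def)
next
  case (Suc n)
  let ?D = "\<lambda>n. frag_extend (small_homotopy X \<C> n)"
  have D: "singular_chain (Suc n) X (?D n c) \<and>
      small_chain n X \<C> (c - ?D (n - 1) (chain_boundary n c) - chain_boundary (Suc n) (?D n c))"
    if "singular_chain n X c" for c
    using that unfolding singular_chain_def[of n]
  proof (induction c rule: frag_induction)
    case (diff a b)
    have eq: "a - b - ?D (n - 1) (chain_boundary n (a - b)) - chain_boundary (Suc n) (?D n (a - b)) =
        (a - ?D (n - 1) (chain_boundary n a) - chain_boundary (Suc n) (?D n a)) -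
        (b - ?D (n - 1) (chain_boundary n b) - chain_boundary (Suc n) (?D n b))"
      by (simp add: chain_boundary_diff frag_extend_diff)
    show ?case
      unfolding eq using diff by (simp add: small_chain_diff singular_chain_diff frag_extend_diff)
  qed (use Suc.IH in auto)
  let ?s = "frag_of \<sigma>" and ?ds = "chain_boundary (Suc n) (frag_of \<sigma>)"
  have s: "singular_chain (Suc n) X ?s" using Suc.prems by (simp add: singular_chain_of)
  then have ds: "singular_chain n X ?ds" by (rule singular_chain_boundary_alt)
  have "chain_boundary n ?ds = 0" using s by (rule chain_boundary_boundary_alt)
  then have "small_chain n X \<C> (chain_boundary (Suc n) (?s - ?D n ?ds))"
    using D[OF ds] by (simp add: chain_boundary_diff)
  moreover have "singular_chain (Suc n) X (?s - ?D n ?ds)"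
    using s D[OF ds] by (blast intro: singular_chain_diff)
  ultimately have "\<exists>w. singular_chain (Suc (Suc n)) X w \<and>
      small_chain (Suc n) X \<C> (?s - ?D n ?ds - chain_boundary (Suc (Suc n)) w)"
    by (intro small_mod_boundary \<C>) auto
  from someI_ex[OF this] show ?case by simp
qed

text \<open>
  Pairing with \<open>c\<close> turns the contraction into an honest null homotopy, because \<open>c\<close> does not see small chains.
\<close>

lemma cocycle_vanishing_on_small_simplices:
  assumes \<C>: "\<And>V. V \<in> \<C> \<Longrightarrow> openin X V" "topspace X \<subseteq> \<Union>\<C>" and c: "c \<in> cocycles n X"
    and van: "\<And>V \<sigma>. V \<in> \<C> \<Longrightarrow> singular_simplex n (subtopology X V) \<sigma> \<Longrightarrow> c \<sigma> = 0"
  shows "c \<in> coboundaries n X"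
proof (rule coboundaries_of_chain_homotopy[where d = "small_homotopy X \<C>", OF _ c])
  show "c \<in> cochains n X" using c by (simp add: cocycles_def)
  fix \<sigma> assume s: "singular_simplex n X \<sigma>"
  note h = small_homotopy[OF \<C> s]
  then show "singular_chain (Suc n) X (small_homotopy X \<C> n \<sigma>)" by blast
  let ?D = "frag_extend (small_homotopy X \<C> (n - 1)) (chain_boundary n (frag_of \<sigma>))"
  let ?d = "chain_boundary (Suc n) (small_homotopy X \<C> n \<sigma>)"
  have "cochain_eval c (frag_of \<sigma> - ?D - ?d) = 0"
    using h van by (intro cochain_eval_eq_0) (auto simp: small_chain_def)
  then show "c \<sigma> = cochain_eval c (?d + ?D)"
    by (simp add: cochain_eval_diff cochain_eval_add algebra_simps)
qed

section \<open>Cup products of relative classes\<close>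

lemma coh_class_eq_zero_iff:
  assumes "c \<in> cochains n X"
  shows "coh_class n X c = coh_class n X (\<lambda>\<sigma>. 0) \<longleftrightarrow> c \<in> coboundaries n X"
proof
  assume eq: "coh_class n X c = coh_class n X (\<lambda>\<sigma>. 0)"
  have "c \<in> coh_class n X c"
    unfolding coh_class_def using zero_in_coboundaries by force
  then show "c \<in> coboundaries n X"
    unfolding eq by (simp add: coh_class_def)
next
  assume "c \<in> coboundaries n X"
  from coh_class_cong[OF this, of "\<lambda>\<sigma>. 0"] show "coh_class n X c = coh_class n X (\<lambda>\<sigma>. 0)" by simp
qed

lemma cochain_pullback_in_cochains: "cochain_pullback n X f c \<in> cochains n X"
  by (simp add: cochains_def cochain_pullback_def)

lemma cochain_pullback_in_coboundaries:
  assumes f: "continuous_map X Y f" and b: "b \<in> coboundaries n Y"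
  shows "cochain_pullback n X f b \<in> coboundaries n X"
proof (cases n)
  case 0
  then show ?thesis using b by (auto simp: coboundaries_def cochain_pullback_def)
next
  case (Suc m)
  then obtain e where "e \<in> cochains m Y" "b = coboundary m Y e"
    using b by (auto simp: coboundaries_def)
  then show ?thesis
    using cochain_pullback_in_cochains[of m X f e]
    unfolding coboundaries_def Suc by (auto simp flip: coboundary_cochain_pullback[OF f])
qed

lemma cochain_pullback_compose:
  assumes "continuous_map X Y f"
  shows "cochain_pullback n X f (cochain_pullback n Y g c) = cochain_pullback n X (g \<circ> f) c"
  using singular_simplex_simplex_map[OF _ assms]
  by (auto simp: cochain_pullback_def simplex_map_compose fun_eq_iff)

lemma cocycle_representatives:
  assumes "\<And>n. u n \<in> cohomology_group n X"
  obtains c where "\<And>n. c n \<in> cocycles n X" "u = (\<lambda>n. coh_class n X (c n))"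
proof -
  have "\<forall>n. \<exists>c. c \<in> cocycles n X \<and> u n = coh_class n X c"
    using assms by (auto simp: cohomology_group_def)
  then obtain c where "\<forall>n. c n \<in> cocycles n X \<and> u n = coh_class n X (c n)" by metis
  then show ?thesis by (intro that[of c]) auto
qed

lemma coh_induced_eq_zero_iff:
  assumes "continuous_map X Y f"
  shows "coh_induced X f (\<lambda>n. coh_class n Y (c n)) = coh_zero X \<longleftrightarrow>
         (\<forall>n. cochain_pullback n X f (c n) \<in> coboundaries n X)"
  by (simp add: fun_eq_iff[where f = "coh_induced X f (\<lambda>n. coh_class n Y (c n))"] coh_zero_def
      coh_induced_coh_class[OF assms] coh_class_eq_zero_iff[OF cochain_pullback_in_cochains])

lemma continuous_map_inclusion: "continuous_map (subtopology X S) X (\<lambda>x. x)"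
  by (rule continuous_map_from_subtopology) (rule continuous_map_id[unfolded id_def])

lemma restriction_at_simplex:
  assumes "singular_simplex n (subtopology X V) \<sigma>"
  shows "cochain_pullback n (subtopology X V) (\<lambda>x. x) c \<sigma> = c \<sigma>"
  using assms simplex_map_id_gen[OF assms, of "\<lambda>x. x"] by (simp add: cochain_pullback_def)

text \<open>
  A class that restricts to zero on \<open>V\<close> comes from the relative cohomology of \<open>(X, V)\<close>: if the
  restriction of the cocycle \<open>c\<close> is \<open>\<delta>e\<close>, extend \<open>e\<close> by zero to all simplices of \<open>X\<close> and subtract its coboundary from \<open>c\<close>.
\<close>

lemma relative_representative:
  assumes u: "\<And>n. u n \<in> cohomology_group n X" and z: "coh_restrict X V u = coh_zero (subtopology X V)"
  obtains c where "\<And>n. c n \<in> cocycles n X" "u = (\<lambda>n. coh_class n X (c n))"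
    "\<And>n \<sigma>. singular_simplex n (subtopology X V) \<sigma> \<Longrightarrow> c n \<sigma> = 0"
proof -
  obtain c where c: "\<And>n. c n \<in> cocycles n X" "u = (\<lambda>n. coh_class n X (c n))"
    using cocycle_representatives[OF u] by blast
  let ?r = "\<lambda>n. cochain_pullback n (subtopology X V) (\<lambda>x. x) (c n)"
  have r: "?r n \<in> coboundaries n (subtopology X V)" for n
    using z unfolding c(2) coh_induced_eq_zero_iff[OF continuous_map_inclusion] by blast
  have "\<exists>c'. c' \<in> cocycles n X \<and> coh_class n X (c n) = coh_class n X c' \<and>
          (\<forall>\<sigma>. singular_simplex n (subtopology X V) \<sigma> \<longrightarrow> c' \<sigma> = 0)" for n
  proof (cases n)
    case 0
    then have "?r n = (\<lambda>\<sigma>. 0)" using r[of n] by (simp add: coboundaries_def)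
    then show ?thesis
      using c(1) restriction_at_simplex by (metis (no_types))
  next
    case (Suc m)
    obtain e where e: "e \<in> cochains m (subtopology X V)" "?r n = coboundary m (subtopology X V) e"
      using r[of n] by (auto simp: coboundaries_def Suc)
    have "e \<in> cochains m X"
      using e(1) by (auto simp: cochains_def singular_simplex_subtopology)
    then have "coboundary m X e \<in> coboundaries n X" by (simp add: coboundaries_def Suc)
    from coboundaries_scale[OF this, of "-1"]
    have b: "(\<lambda>\<sigma>. - coboundary m X e \<sigma>) \<in> coboundaries n X" by simp
    show ?thesis
    proof (intro exI[of _ "\<lambda>\<sigma>. c n \<sigma> + - coboundary m X e \<sigma>"] conjI allI impI)
      show "(\<lambda>\<sigma>. c n \<sigma> + - coboundary m X e \<sigma>) \<in> cocycles n X"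
        by (rule cocycles_add[OF c(1) subsetD[OF coboundaries_subset_cocycles b]])
      show "coh_class n X (c n) = coh_class n X (\<lambda>\<sigma>. c n \<sigma> + - coboundary m X e \<sigma>)"
        using coh_class_cong[OF b] by simp
      fix \<sigma> assume s: "singular_simplex n (subtopology X V) \<sigma>"
      then have "c n \<sigma> = coboundary m (subtopology X V) e \<sigma>"
        using restriction_at_simplex e(2) by metis
      also have "\<dots> = coboundary m X e \<sigma>"
        using s by (simp add: coboundary_def Suc singular_simplex_subtopology)
      finally show "c n \<sigma> + - coboundary m X e \<sigma> = 0" by simp
    qed
  qed
  then obtain c' where "\<forall>n. c' n \<in> cocycles n X \<and> coh_class n X (c n) = coh_class n X (c' n) \<and>
          (\<forall>\<sigma>. singular_simplex n (subtopology X V) \<sigma> \<longrightarrow> c' n \<sigma> = 0)" by metis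
  then show ?thesis by (intro that[of c']) (simp_all add: c(2))
qed

lemma cochain_cup_cocycle:
  assumes "c \<in> cocycles i X" "d \<in> cocycles j X"
  shows "cochain_cup i j X c d \<in> cocycles (i + j) X"
  using assms by (simp add: cocycles_def cochain_cup_in_cochains coboundary_cochain_cup cochain_cup_zero)

lemma zero_in_cocycles: "(\<lambda>\<sigma>. 0) \<in> cocycles n X"
  by (rule subsetD[OF coboundaries_subset_cocycles zero_in_coboundaries])

lemma cocycles_sum:
  assumes "finite I" "\<And>i. i \<in> I \<Longrightarrow> c i \<in> cocycles n X"
  shows "(\<lambda>\<sigma>. \<Sum>i\<in>I. c i \<sigma>) \<in> cocycles n X"
  using assms by (induction I rule: finite_induct) (auto intro: cocycles_add zero_in_cocycles)

lemma unit_cocycle: "(\<lambda>\<sigma>. if singular_simplex 0 X \<sigma> then 1 else 0) \<in> cocycles 0 X"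
proof -
  have "singular_simplex 0 X (singular_face (Suc 0) k \<sigma>)" if "singular_simplex (Suc 0) X \<sigma>" "k \<le> 1" for k \<sigma>
    using singular_simplex_singular_face[OF that(1), of k] that(2) by simp
  then show ?thesis
    by (auto simp: cocycles_def cochains_def coboundary_def fun_eq_iff)
qed

text \<open>
  A cup product of cochains vanishes at a simplex of \<open>V i\<close> as soon as its \<open>i\<close>-th factor vanishes on all simplices of \<open>V i\<close>,
  because every factor is evaluated at a face of that simplex.
\<close>

lemma cup_list_representative:
  assumes "\<And>i. i < length us \<Longrightarrow> us ! i \<in> cohomology X"
    and "\<And>i. i < length us \<Longrightarrow> coh_restrict X (V i) (us ! i) = coh_zero (subtopology X (V i))"
  shows "\<exists>c. (\<forall>n. c n \<in> cocycles n X) \<and> cup_list X us = (\<lambda>n. coh_class n X (c n)) \<and>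
    (\<forall>n \<sigma> i. i < length us \<longrightarrow> singular_simplex n (subtopology X (V i)) \<sigma> \<longrightarrow> c n \<sigma> = 0)"
  using assms
proof (induction us arbitrary: V)
  case Nil
  let ?c = "\<lambda>n. if n = 0 then (\<lambda>\<sigma>. if singular_simplex 0 X \<sigma> then 1 else 0) else (\<lambda>\<sigma>. 0)"
  have c: "?c n \<in> cocycles n X" for n
    using unit_cocycle zero_in_cocycles by auto
  have cup: "cup_list X [] = (\<lambda>n. coh_class n X (?c n))"
    by (simp add: cup_list_def coh_one_def coh_zero_def fun_eq_iff)
  show ?case by (intro exI[of _ ?c] conjI allI impI c cup) simp
next
  case (Cons u us)
  have "us ! i \<in> cohomology X"
    "coh_restrict X (V (Suc i)) (us ! i) = coh_zero (subtopology X (V (Suc i)))"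
    if "i < length us" for i
    using Cons.prems[of "Suc i"] that by simp_all
  from Cons.IH[OF this] obtain d where d: "\<And>n. d n \<in> cocycles n X"
    "cup_list X us = (\<lambda>n. coh_class n X (d n))"
    "\<And>n \<sigma> i. i < length us \<Longrightarrow> singular_simplex n (subtopology X (V (Suc i))) \<sigma> \<Longrightarrow> d n \<sigma> = 0"
    by blast
  have "\<And>n. u n \<in> cohomology_group n X" "coh_restrict X (V 0) u = coh_zero (subtopology X (V 0))"
    using Cons.prems(1,2)[of 0] by (auto simp: cohomology_def)
  then obtain c where c: "\<And>n. c n \<in> cocycles n X" "u = (\<lambda>n. coh_class n X (c n))"
    "\<And>n \<sigma>. singular_simplex n (subtopology X (V 0)) \<sigma> \<Longrightarrow> c n \<sigma> = 0"
    by (rule relative_representative) blast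
  let ?e = "\<lambda>n \<sigma>. \<Sum>i\<le>n. cochain_cup i (n - i) X (c i) (d (n - i)) \<sigma>"
  have "cochain_cup i (n - i) X (c i) (d (n - i)) \<in> cocycles n X" if "i \<le> n" for i n
    using cochain_cup_cocycle[OF c(1)[of i] d(1)[of "n - i"]] that by simp
  then have "?e n \<in> cocycles n X" for n
    by (intro cocycles_sum) auto
  moreover have "cup_list X (u # us) = (\<lambda>n. coh_class n X (?e n))"
    using cup_coh_class[of _ c X d] c d by (auto simp: cup_list_def)
  moreover have "?e n \<sigma> = 0"
    if "i < length (u # us)" "singular_simplex n (subtopology X (V i)) \<sigma>" for n \<sigma> i
  proof (intro sum.neutral ballI)
    fix j assume "j \<in> {..n}"
    then have s: "singular_simplex (j + (n - j)) (subtopology X (V i)) \<sigma>" using that by simp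
    have "c j (front_face j \<sigma>) = 0 \<or> d (n - j) (back_face j (n - j) \<sigma>) = 0"
      using that(1) c(3) d(3) singular_simplex_front_face[OF s] singular_simplex_back_face[OF s]
      by (cases i) auto
    then show "cochain_cup j (n - j) X (c j) (d (n - j)) \<sigma> = 0"
      by (auto simp: cochain_cup_def)
  qed
  ultimately show ?case by (intro exI[of _ ?e]) blast
qed

text \<open>
  If \<open>V\<close> can be deformed into \<open>A\<close> inside \<open>X\<close>, then by homotopy invariance the restriction of a class
  to \<open>V\<close> is the pullback of its restriction to \<open>A\<close>.
\<close>

lemma restrict_zero_of_homotopic:
  assumes u: "\<And>n. u n \<in> cohomology_group n X"
    and z: "coh_restrict X A u = coh_zero (subtopology X A)"
    and hom: "homotopic_with (\<lambda>_. True) (subtopology X V) X g (\<lambda>x. x)"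
    and A: "g ` (topspace X \<inter> V) \<subseteq> A"
  shows "coh_restrict X V u = coh_zero (subtopology X V)"
proof -
  obtain c where c: "\<And>n. c n \<in> cocycles n X" "u = (\<lambda>n. coh_class n X (c n))"
    using cocycle_representatives[OF u] by blast
  have gA: "continuous_map (subtopology X V) (subtopology X A) g"
    using homotopic_with_imp_continuous_maps[OF hom] A by (auto simp: continuous_map_in_subtopology)
  have "cochain_pullback n (subtopology X V) (\<lambda>x. x) (c n) \<in> coboundaries n (subtopology X V)" for n
  proof -
    have "cochain_pullback n (subtopology X A) (\<lambda>x. x) (c n) \<in> coboundaries n (subtopology X A)"
      using z unfolding c(2) coh_induced_eq_zero_iff[OF continuous_map_inclusion] by blast
    from cochain_pullback_in_coboundaries[OF gA this]
    have "cochain_pullback n (subtopology X V) g (c n) \<in> coboundaries n (subtopology X V)"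
      by (simp add: cochain_pullback_compose[OF gA] o_def)
    from coboundaries_add[OF homotopic_imp_pullback_cohomologous[OF hom c(1)] this] show ?thesis by simp
  qed
  then show ?thesis
    unfolding c(2) coh_induced_eq_zero_iff[OF continuous_map_inclusion] by blast
qed

text \<open>
  The Lusternik-Schnirelmann argument: the product lies in the cohomology of \<open>X\<close> relative to a covering family of
  open sets, and this is zero by subdivision.
\<close>

lemma cup_list_zero_of_cover:
  assumes "\<And>i. i < length us \<Longrightarrow> us ! i \<in> cohomology X"
    and "\<And>i. i < length us \<Longrightarrow> openin X (V i)" and cover: "topspace X \<subseteq> (\<Union>i<length us. V i)"
    and "\<And>i. i < length us \<Longrightarrow> coh_restrict X (V i) (us ! i) = coh_zero (subtopology X (V i))"
  shows "cup_list X us = coh_zero X"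
proof -
  obtain c where c: "\<And>n. c n \<in> cocycles n X" "cup_list X us = (\<lambda>n. coh_class n X (c n))"
    "\<And>n \<sigma> i. i < length us \<Longrightarrow> singular_simplex n (subtopology X (V i)) \<sigma> \<Longrightarrow> c n \<sigma> = 0"
    using cup_list_representative[OF assms(1,4)] by blast
  have "c n \<in> coboundaries n X" for n
    by (rule cocycle_vanishing_on_small_simplices[of "V ` {..<length us}"]) (use assms(2) cover c in auto)
  then have "coh_class n X (c n) = coh_class n X (\<lambda>\<sigma>. 0)" for n
    using coh_class_eq_zero_iff[of "c n" n X] c(1) by (simp add: cocycles_def)
  then show ?thesis by (simp only: c(2) coh_zero_def)
qed

section \<open>Orbit spaces and equivariant deformations\<close>

lemma continuous_map_act:
  fixes \<alpha> :: "'g::topological_group_add \<Rightarrow> 'a \<Rightarrow> 'a"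
  assumes "G_space \<alpha> X"
  shows "continuous_map X X (\<alpha> g)"
proof -
  have "continuous_map X (prod_topology euclidean X) (\<lambda>x. (g, x))"
    by (intro continuous_map_pairedI) auto
  from continuous_map_compose[OF this G_spaceD(2)[OF assms]] show ?thesis by (simp add: o_def)
qed

lemma orbit_of_act:
  assumes "G_space \<alpha> X" "x \<in> topspace X"
  shows "orbit_of \<alpha> (\<alpha> g x) = orbit_of \<alpha> x"
proof -
  note X = G_spaceD[OF assms(1)]
  have "\<alpha> h (\<alpha> g x) \<in> orbit_of \<alpha> x" for h
    using X(4)[OF assms(2), of h g] by (auto simp: orbit_of_def intro!: rangeI simp flip: X(4)[OF assms(2)])
  moreover have "\<alpha> h x \<in> orbit_of \<alpha> (\<alpha> g x)" for h
    using X(4)[OF assms(2), of "h - g" g] by (auto simp: orbit_of_def)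
  ultimately show ?thesis by (auto simp: orbit_of_def)
qed

lemma orbit_of_eqE:
  assumes "G_space \<alpha> X" "x \<in> topspace X" "orbit_of \<alpha> x = orbit_of \<alpha> y"
  obtains g where "x = \<alpha> g y"
proof -
  have "x \<in> orbit_of \<alpha> x"
    using G_spaceD(3)[OF assms(1,2)] by (auto simp: orbit_of_def intro: range_eqI[of _ _ 0])
  then show ?thesis using assms(3) that by (auto simp: orbit_of_def)
qed

text \<open>
  The saturation of an open set is the union of its translates.
\<close>

lemma open_map_orbit_of:
  assumes G: "G_space \<alpha> X"
  shows "open_map X (orbit_space \<alpha> X) (orbit_of \<alpha>)"
  unfolding open_map_def openin_orbit_space
proof (intro allI impI conjI)
  fix U assume U: "openin X U"
  then have UX: "U \<subseteq> topspace X" by (rule openin_subset)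
  then show "orbit_of \<alpha> ` U \<subseteq> orbit_of \<alpha> ` topspace X" by blast
  have "{x \<in> topspace X. orbit_of \<alpha> x \<in> orbit_of \<alpha> ` U} = (\<Union>g. {x \<in> topspace X. \<alpha> g x \<in> U})"
  proof (intro equalityI subsetI)
    fix x assume "x \<in> {x \<in> topspace X. orbit_of \<alpha> x \<in> orbit_of \<alpha> ` U}"
    then obtain y where x: "x \<in> topspace X" "y \<in> U" "orbit_of \<alpha> y = orbit_of \<alpha> x" by auto
    then obtain g where "y = \<alpha> g x" using orbit_of_eqE[OF G] UX by blast
    then show "x \<in> (\<Union>g. {x \<in> topspace X. \<alpha> g x \<in> U})" using x by blast
  next
    fix x assume "x \<in> (\<Union>g. {x \<in> topspace X. \<alpha> g x \<in> U})"
    then obtain g where x: "x \<in> topspace X" "\<alpha> g x \<in> U" by auto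
    then have "orbit_of \<alpha> x = orbit_of \<alpha> (\<alpha> g x)" using orbit_of_act[OF G] by metis
    then show "x \<in> {x \<in> topspace X. orbit_of \<alpha> x \<in> orbit_of \<alpha> ` U}" using x by blast
  qed
  moreover have "openin X (\<Union>g. {x \<in> topspace X. \<alpha> g x \<in> U})"
    using openin_continuous_map_preimage[OF continuous_map_act[OF G] U] by blast
  ultimately show "openin X {x \<in> topspace X. orbit_of \<alpha> x \<in> orbit_of \<alpha> ` U}" by simp
qed

lemma open_map_prod_id:
  assumes f: "open_map X Y f"
  shows "open_map (prod_topology Z X) (prod_topology Z Y) (map_prod id f)"
  unfolding open_map_def
proof (intro allI impI)
  fix W assume W: "openin (prod_topology Z X) W"
  show "openin (prod_topology Z Y) (map_prod id f ` W)"
    unfolding openin_prod_topology_alt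
  proof (intro allI impI)
    fix z y assume "(z, y) \<in> map_prod id f ` W"
    then obtain x where "(z, x) \<in> W" "y = f x" by auto
    then obtain A U where "openin Z A" "openin X U" "z \<in> A" "x \<in> U" "A \<times> U \<subseteq> W"
      using W unfolding openin_prod_topology_alt by metis
    moreover have "openin Y (f ` U)" using f \<open>openin X U\<close> by (simp add: open_map_def)
    moreover have "A \<times> f ` U \<subseteq> map_prod id f ` W" using \<open>A \<times> U \<subseteq> W\<close> by force
    ultimately show "\<exists>A V. openin Z A \<and> openin Y V \<and> z \<in> A \<and> y \<in> V \<and> A \<times> V \<subseteq> map_prod id f ` W"
      using \<open>y = f x\<close> by blast
  qed
qed

text \<open>
  Openness of the orbit map is inherited by products and by restriction to open subsets, and an open continuous
  surjection is a quotient map.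
\<close>

lemma quotient_map_cylinder_orbit_of:
  assumes G: "G_space \<alpha> X" and U: "openin X U"
  shows "quotient_map (cylinder (subtopology X U))
    (cylinder (subtopology (orbit_space \<alpha> X) (orbit_of \<alpha> ` U))) (map_prod id (orbit_of \<alpha>))"
proof (rule continuous_open_imp_quotient_map)
  let ?Q = "subtopology (orbit_space \<alpha> X) (orbit_of \<alpha> ` U)"
  have UX: "U \<subseteq> topspace X" using U by (rule openin_subset)
  have "continuous_map (subtopology X U) ?Q (orbit_of \<alpha>)"
    using quotient_imp_continuous_map[OF quotient_map_orbit_of, of X \<alpha>]
    by (auto simp: continuous_map_in_subtopology continuous_map_from_subtopology)
  then show "continuous_map (cylinder (subtopology X U)) (cylinder ?Q) (map_prod id (orbit_of \<alpha>))"
    unfolding map_prod_def case_prod_unfold id_def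
    by (intro continuous_map_pairedI continuous_map_fst continuous_map_compose[OF continuous_map_snd, unfolded o_def])
  have "open_map (subtopology X U) ?Q (orbit_of \<alpha>)"
    by (intro open_map_into_subtopology open_map_from_subtopology open_map_orbit_of G U) auto
  then show "open_map (cylinder (subtopology X U)) (cylinder ?Q) (map_prod id (orbit_of \<alpha>))"
    by (rule open_map_prod_id)
  show "map_prod id (orbit_of \<alpha>) ` topspace (cylinder (subtopology X U)) = topspace (cylinder ?Q)"
    using UX by (auto simp: topspace_orbit_space map_prod_surj_on)
qed

text \<open>
  Equivariance makes \<open>orbit_of \<alpha> \<circ> h\<close> constant on the fibres of the quotient map of cylinders, so that it
  descends to a homotopy of the images in the orbit space.
\<close>

lemma orbit_space_homotopic:
  assumes G: "G_space \<alpha> X" and U: "openin X U" "G_invariant \<alpha> U"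
    and hom: "G_homotopic \<alpha> (subtopology X U) \<alpha> X f (\<lambda>x. x)"
  obtains g where
    "homotopic_with (\<lambda>_. True) (subtopology (orbit_space \<alpha> X) (orbit_of \<alpha> ` U)) (orbit_space \<alpha> X) g (\<lambda>x. x)"
    "\<And>x. x \<in> U \<Longrightarrow> g (orbit_of \<alpha> x) = orbit_of \<alpha> (f x)"
proof -
  have UX: "U \<subseteq> topspace X" using U(1) by (rule openin_subset)
  obtain h where h: "continuous_map (cylinder (subtopology X U)) X h"
    "\<And>x. h (0, x) = f x" "\<And>x. h (1, x) = x"
    "\<And>t. t \<in> {0..1} \<Longrightarrow> equivariant_on U \<alpha> \<alpha> (\<lambda>x. h (t, x))"
    using hom UX by (auto simp: G_homotopic_def homotopic_with_def Int_absorb1)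
  define pick where "pick = (\<lambda>q. SOME x. x \<in> U \<and> orbit_of \<alpha> x = q)"
  define k where "k = (\<lambda>w. orbit_of \<alpha> (h (fst w, pick (snd w))))"
  let ?V = "subtopology (orbit_space \<alpha> X) (orbit_of \<alpha> ` U)"
  have k: "k (t, orbit_of \<alpha> x) = orbit_of \<alpha> (h (t, x))" if "t \<in> {0..1}" "x \<in> U" for t x
  proof -
    let ?y = "pick (orbit_of \<alpha> x)"
    have y: "?y \<in> U \<and> orbit_of \<alpha> ?y = orbit_of \<alpha> x"
      unfolding pick_def by (rule someI[of _ x]) (use that in simp)
    then obtain g where g: "?y = \<alpha> g x" using orbit_of_eqE[OF G, of ?y x] UX by blast
    have "h (t, ?y) = \<alpha> g (h (t, x))"
      using h(4)[OF that(1)] that(2) by (simp add: g equivariant_on_def)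
    moreover have "h (t, x) \<in> topspace X"
      using h(1) that UX by (auto simp: continuous_map_def Pi_iff)
    ultimately show ?thesis using orbit_of_act[OF G] by (simp add: k_def)
  qed
  have "continuous_map (cylinder (subtopology X U)) (orbit_space \<alpha> X) (orbit_of \<alpha> \<circ> h)"
    using h(1) quotient_imp_continuous_map[OF quotient_map_orbit_of] by (rule continuous_map_compose)
  then have "continuous_map (cylinder (subtopology X U)) (orbit_space \<alpha> X) (k \<circ> map_prod id (orbit_of \<alpha>))"
    by (rule continuous_map_eq) (auto simp: k)
  then have kc: "continuous_map (cylinder ?V) (orbit_space \<alpha> X) k"
    by (rule continuous_compose_quotient_map[OF quotient_map_cylinder_orbit_of[OF G U(1)]])
  have "k (1, q) = q" if "q \<in> topspace ?V" for q
    using that k by (auto simp: h)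
  then have "homotopic_with (\<lambda>_. True) ?V (orbit_space \<alpha> X) (\<lambda>q. k (0, q)) (\<lambda>x. x)"
    by (subst homotopic_with) (use kc in \<open>auto intro!: exI[of _ k]\<close>)
  then show ?thesis using k h(2) by (intro that[of "\<lambda>q. k (0, q)"]) auto
qed

lemma G_space_fibre_product:
  fixes \<alpha> :: "'g::topological_group_add \<Rightarrow> 'e \<Rightarrow> 'e"
  assumes E: "G_space \<alpha> E" and p: "G_map \<alpha> E \<beta> B p"
  shows "G_space (prod_act \<alpha> \<alpha>) (fibre_product E p)"
  unfolding fibre_product_def
proof (intro G_space_subtopology G_space_prod_topology E)
  show "G_invariant (prod_act \<alpha> \<alpha>) (topspace (prod_topology E E) \<inter> {(e, e'). p e = p e'})"
    using p G_spaceD(5)[OF E] by (auto simp: G_invariant_def prod_act_def G_map_def equivariant_on_def)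
qed

text \<open>
  The end point of the path \<open>s y\<close> runs back along the path to its start.  The path stays in one fibre of \<open>p\<close>, so the pair remains in the fibre product.
\<close>

lemma section_contracts_to_diagonal:
  fixes \<alpha> :: "'g::topological_group_add \<Rightarrow> 'e \<Rightarrow> 'e"
  assumes s: "G_map \<eta> Y (path_act \<alpha>) (fibre_paths E p) s"
  shows "G_homotopic \<eta> Y (prod_act \<alpha> \<alpha>) (fibre_product E p)
           (\<lambda>y. (s y 0, s y 0)) (\<lambda>y. (s y 0, s y 1))"
proof -
  have sc: "continuous_map Y (path_topology E) s"
    and sf: "\<And>y. y \<in> topspace Y \<Longrightarrow> \<exists>b. \<forall>t\<in>{0..1}. p (s y t) = b"
    using s by (auto simp: G_map_def fibre_paths_def continuous_map_in_subtopology)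
  have ev: "continuous_map (cylinder Y) E (\<lambda>w. s (snd w) (r (fst w)))"
    if "continuous_map unit_interval unit_interval r" for r
  proof -
    have "continuous_map (cylinder Y) (cylinder (path_topology E)) (\<lambda>w. (r (fst w), s (snd w)))"
      by (intro continuous_map_pairedI continuous_map_compose[OF continuous_map_fst that, unfolded o_def]
          continuous_map_compose[OF continuous_map_snd sc, unfolded o_def])
    from continuous_map_compose[OF this continuous_map_path_eval] show ?thesis by (simp add: o_def)
  qed
  let ?h = "\<lambda>w. (s (snd w) 0, s (snd w) (fst w))"
  have "continuous_map (cylinder Y) (fibre_product E p) ?h"
    unfolding fibre_product_def continuous_map_in_subtopology
    using ev[of "\<lambda>_. 0"] ev[of "\<lambda>t. t"] sf by (fastforce intro!: continuous_map_pairedI)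
  moreover have "equivariant_on (topspace Y) \<eta> (prod_act \<alpha> \<alpha>) (\<lambda>y. ?h (t, y))" if "t \<in> {0..1}" for t
    using s that by (simp add: G_map_def equivariant_on_def path_act_def prod_act_def)
  ultimately show ?thesis
    unfolding G_homotopic_def homotopic_with_def by (intro exI[of _ ?h]) auto
qed

lemma secat_G_le_enatE:
  assumes "secat_G \<xi> X \<eta> Y q \<le> enat m"
  obtains k U s where "0 < k" "k \<le> m" "(\<Union>i<k. U i) = topspace Y"
    "\<And>i. i < k \<Longrightarrow> openin Y (U i) \<and> G_invariant \<eta> (U i) \<and>
        G_map \<eta> (subtopology Y (U i)) \<xi> X (s i) \<and>
        G_homotopic \<eta> (subtopology Y (U i)) \<eta> Y (q \<circ> s i) (\<lambda>y. y)"
proof -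
  define ok where "ok k U s \<longleftrightarrow> 0 < k \<and> (\<Union>i<k. U i) = topspace Y \<and>
          (\<forall>i<k. openin Y (U i) \<and> G_invariant \<eta> (U i) \<and>
                 G_map \<eta> (subtopology Y (U i)) \<xi> X (s i) \<and>
                 G_homotopic \<eta> (subtopology Y (U i)) \<eta> Y (q \<circ> s i) (\<lambda>y. y))"
    for k :: nat and U s
  let ?S = "{enat k |k. \<exists>U s. ok k U s}"
  have le: "Inf ?S \<le> enat m" using assms by (simp add: secat_G_def ok_def)
  then have "?S \<noteq> {}" by (metis Inf_enat_def infinity_ileE)
  then have "Inf ?S \<in> ?S"
    unfolding Inf_enat_def by (simp only: if_False) (rule LeastI_ex, blast)
  then obtain k U s where k: "ok k U s" "Inf ?S = enat k" by blast
  have "k \<le> m" using le unfolding k(2) by simp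
  then show ?thesis using k(1) unfolding ok_def by (intro that[of k U s]) auto
qed

section \<open>The cup length bound\<close>

theorem theorem3p6:
  fixes \<alpha> :: "'g::topological_group_add \<Rightarrow> 'e \<Rightarrow> 'e" and E :: "'e topology"
    and \<beta> :: "'g \<Rightarrow> 'b \<Rightarrow> 'b" and B :: "'b topology" and p :: "'e \<Rightarrow> 'b"
    and us :: "(('e \<times> 'e) set, 'r::comm_ring_1) coh_family list"
  assumes "G_space \<alpha> E" and "G_space \<beta> B" and "G_fibration \<alpha> E \<beta> B p"
    and "\<forall>u\<in>set us. u \<in> cohomology (orbit_fibre_product \<alpha> E p)"
    and "\<forall>u\<in>set us. coh_restrict (orbit_fibre_product \<alpha> E p) (orbit_diagonal \<alpha> E) u =
                     coh_zero (subtopology (orbit_fibre_product \<alpha> E p) (orbit_diagonal \<alpha> E))"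
    and "cup_list (orbit_fibre_product \<alpha> E p) us \<noteq> coh_zero (orbit_fibre_product \<alpha> E p)"
  shows "TC_G \<alpha> E p > enat (length us)"
proof (rule ccontr)
  let ?X = "fibre_product E p" and ?Q = "orbit_fibre_product \<alpha> E p"
  let ?act = "prod_act \<alpha> \<alpha>" and ?A = "orbit_diagonal \<alpha> E"
  let ?\<pi> = "orbit_of ?act"
  assume "\<not> TC_G \<alpha> E p > enat (length us)"
  then have "TC_G \<alpha> E p \<le> enat (length us)" by simp
  then obtain k U s where k: "0 < k" "k \<le> length us" and cover: "(\<Union>i<k. U i) = topspace ?X"
    and U: "\<And>i. i < k \<Longrightarrow> openin ?X (U i) \<and> G_invariant ?act (U i) \<and>
        G_map ?act (subtopology ?X (U i)) (path_act \<alpha>) (fibre_paths E p) (s i) \<and>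
        G_homotopic ?act (subtopology ?X (U i)) ?act ?X ((\<lambda>\<gamma>. (\<gamma> 0, \<gamma> 1)) \<circ> s i) (\<lambda>y. y)"
    unfolding TC_G_def by (rule secat_G_le_enatE) blast
  have G: "G_space ?act ?X"
    using assms(1,3) by (auto simp: G_fibration_def intro: G_space_fibre_product)
  have restrict: "coh_restrict ?Q (?\<pi> ` U i) u = coh_zero (subtopology ?Q (?\<pi> ` U i))"
    if i: "i < k" and u: "u \<in> set us" for i u
  proof -
    let ?d = "\<lambda>y. (s i y 0, s i y 0)"
    \<comment> \<open>Deform \<open>U i\<close> first to the end points of the paths chosen by \<open>s i\<close>, and then into the diagonal.\<close>
    have hom: "G_homotopic ?act (subtopology ?X (U i)) ?act ?X ?d (\<lambda>y. y)"
      using section_contracts_to_diagonal[of ?act "subtopology ?X (U i)" \<alpha> E p "s i"] U[OF i]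
      unfolding G_homotopic_def o_def by (blast intro: homotopic_with_trans)
    have "openin ?X (U i)" "G_invariant ?act (U i)" using U[OF i] by auto
    from orbit_space_homotopic[OF G this hom] obtain g where g:
      "homotopic_with (\<lambda>_. True) (subtopology ?Q (?\<pi> ` U i)) ?Q g (\<lambda>x. x)"
      "\<And>x. x \<in> U i \<Longrightarrow> g (?\<pi> x) = ?\<pi> (?d x)"
      unfolding orbit_fibre_product_def by blast
    have "s i x 0 \<in> topspace E" if x: "x \<in> U i" for x
    proof -
      have "x \<in> topspace (subtopology ?X (U i))" using x U[OF i] openin_subset by fastforce
      then have "s i x \<in> paths E"
        using U[OF i] by (auto simp: G_map_def fibre_paths_def continuous_map_def Pi_iff)
      then show ?thesis by (auto simp: paths_def pathin_def continuous_map_def Pi_iff)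
    qed
    then have "g ` (topspace ?Q \<inter> ?\<pi> ` U i) \<subseteq> ?A"
      using g(2) by (auto simp: orbit_diagonal_def)
    then show ?thesis
      using assms(4,5) u by (intro restrict_zero_of_homotopic[OF _ _ g(1)]) (auto simp: cohomology_def)
  qed
  \<comment> \<open>There may be more classes than open sets; the last open set is repeated for the remaining classes.\<close>
  let ?V = "\<lambda>i. ?\<pi> ` U (min i (k - 1))"
  have "cup_list ?Q us = coh_zero ?Q"
  proof (rule cup_list_zero_of_cover[where V = ?V])
    have m: "min i (k - 1) < k" for i using k by auto
    show "openin ?Q (?V i)" for i
      using open_map_orbit_of[OF G] U[OF m] by (simp add: open_map_def orbit_fibre_product_def)
    show "coh_restrict ?Q (?V i) (us ! i) = coh_zero (subtopology ?Q (?V i))" if "i < length us" for i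
      using restrict[OF m] that by simp
    show "topspace ?Q \<subseteq> (\<Union>i<length us. ?V i)"
    proof
      fix q assume "q \<in> topspace ?Q"
      then have "q \<in> ?\<pi> ` (\<Union>i<k. U i)"
        by (simp only: cover orbit_fibre_product_def topspace_orbit_space)
      then obtain x i where "i < k" "x \<in> U i" "q = ?\<pi> x" by blast
      moreover from \<open>i < k\<close> have "i < length us" "min i (k - 1) = i" using k by auto
      ultimately show "q \<in> (\<Union>i<length us. ?V i)" by (intro UN_I[of i]) auto
    qed
  qed (use assms(4) in auto)
  then show False using assms(6) by blast
qed

end
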